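(* Let $\omega:\mathcal A\to\mathcal A^+$ be an admissible tile substitution in $\mathbb R^d$ with FPC. The map $\omega:X_{\mathcal A,\omega}\to X_{\mathcal A,\omega}$ is one-to-one if and only if $\omega$ is non-periodic.
   Context: A tile in $\mathbb R^d$ is a pair $T=(F,i)$ where $F=\operatorname{supp}(T)$ is a (nonempty) compact set that is the closure of its interior and $i$ is a label (type) from a finite set; $T+g=(F+g,i)$. A tiling is a set of tiles whose supports have union $\mathbb R^d$ and such that distinct tiles have supports with disjoint interiors. A patch is a finite set of tiles with pairwise disjoint interiors; $\operatorname{supp}(P)$ is the union of the supports of its tiles. $\mathcal A=\{A_1,\dots,A_N\}$ is a finite set of pairwise translationally inequivalent tiles (prototiles), each with $0\in\operatorname{int}(\operatorname{supp}(A_j))$; $\mathcal A^+$ is the set of patches all of whose tiles are translates of prototiles. Let $\varphi:\mathbb R^d\to\mathbb R^d$ be an expansive linear map (all eigenvalues have modulus $>1$). A tile substitution with expansion $\varphi$ is a map $\omega:\mathcal A\to\mathcal A^+$ with $\operatorname{supp}(\omega(A_j))=\varphi(\operatorname{supp}(A_j))$ for all $j$; it is extended by $\omega(x+A_j)=\varphi(x)+\omega(A_j)$ to translates of prototiles, and tile by tile to patches and tilings. A patch $P$ is legal if $P+x\subseteq\omega^n(A_j)$ for some $n\ge1$, $j$, $x\in\mathbb R^d$. $X_{\mathcal A,\omega}$ is the set of all tilings of $\mathbb R^d$ all of whose patches (finite subsets) are legal; $\omega$ maps it into itself. $\omega$ is admissible if every prototile $A_j$ is a tile of some $\mathcal T\in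 X_{\mathcal A,\omega}$. FPC: for every $R>0$ there are, up to translation, finitely many patches of diameter less than $R$ occurring in tilings of $X_{\mathcal A,\omega}$. $\omega$ is non-periodic if $\mathcal T\in X_{\mathcal A,\omega}$ and $\mathcal T+v=\mathcal T$ with $v\in\mathbb R^d$ imply $v=0$. *)

theory Defs
  imports "HOL-Analysis.Analysis"
begin

type_synonym ('n, 'l) tile = "(real ^ 'n) set \<times> 'l"

definition is_tile :: "('n::finite, 'l) tile \<Rightarrow> bool" where
  "is_tile T \<longleftrightarrow> fst T \<noteq> {} \<and> compact (fst T) \<and> closure (interior (fst T)) = fst T"

definition shift_tile :: "real ^ 'n::finite \<Rightarrow> ('n, 'l) tile \<Rightarrow> ('n, 'l) tile" where
  "shift_tile g T = ((\<lambda>x. x + g) ` fst T, snd T)"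

definition shift :: "real ^ 'n::finite \<Rightarrow> ('n, 'l) tile set \<Rightarrow> ('n, 'l) tile set" where
  "shift g P = shift_tile g ` P"

definition support :: "('n::finite, 'l) tile set \<Rightarrow> (real ^ 'n) set" where
  "support P = (\<Union>T\<in>P. fst T)"

definition non_overlapping :: "('n::finite, 'l) tile set \<Rightarrow> bool" where
  "non_overlapping P \<longleftrightarrow>
     (\<forall>S\<in>P. \<forall>T\<in>P. S \<noteq> T \<longrightarrow> interior (fst S) \<inter> interior (fst T) = {})"

definition tiling :: "('n::finite, 'l) tile set \<Rightarrow> bool" where
  "tiling T \<longleftrightarrow> (\<forall>S\<in>T. is_tile S) \<and> support T = UNIV \<and> non_overlapping T"

definition patch :: "('n::finite, 'l) tile set \<Rightarrow> bool" where
  "patch P \<longleftrightarrow> finite P \<and> (\<forall>S\<in>P. is_tile S) \<and> non_overlapping P"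

definition prototile_set :: "('n::finite, 'l) tile set \<Rightarrow> bool" where
  "prototile_set \<A> \<longleftrightarrow>
     finite \<A> \<and>
     (\<forall>A\<in>\<A>. is_tile A \<and> 0 \<in> interior (fst A)) \<and>
     (\<forall>A\<in>\<A>. \<forall>B\<in>\<A>. \<forall>g. B = shift_tile g A \<longrightarrow> A = B)"

definition patches_over :: "('n::finite, 'l) tile set \<Rightarrow> ('n, 'l) tile set set" where
  "patches_over \<A> = {P. patch P \<and> (\<forall>T\<in>P. \<exists>A\<in>\<A>. \<exists>x. T = shift_tile x A)}"

text \<open>Eigenvalues of a real linear map are complex: they are those of its standard matrix
  acting on complex vectors.\<close>

definition complex_eigenvalue :: "(real ^ 'n::finite \<Rightarrow> real ^ 'n) \<Rightarrow> complex \<Rightarrow> bool" where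
  "complex_eigenvalue \<phi> c \<longleftrightarrow>
     (\<exists>v :: complex ^ 'n. v \<noteq> 0 \<and> (\<chi> i j. complex_of_real (matrix \<phi> $ i $ j)) *v v = c *s v)"

definition expansive :: "(real ^ 'n::finite \<Rightarrow> real ^ 'n) \<Rightarrow> bool" where
  "expansive \<phi> \<longleftrightarrow> linear \<phi> \<and> (\<forall>c. complex_eigenvalue \<phi> c \<longrightarrow> norm c > 1)"

text \<open>In the following, \<open>\<omega>\<close> is only relevant on the prototile set \<open>\<A>\<close>.\<close>

definition tile_substitution ::
  "('n::finite, 'l) tile set \<Rightarrow> (real ^ 'n \<Rightarrow> real ^ 'n) \<Rightarrow> (('n, 'l) tile \<Rightarrow> ('n, 'l) tile set) \<Rightarrow> bool" where
  "tile_substitution \<A> \<phi> \<omega> \<longleftrightarrow>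
     prototile_set \<A> \<and> expansive \<phi> \<and>
     (\<forall>A\<in>\<A>. \<omega> A \<in> patches_over \<A> \<and> support (\<omega> A) = \<phi> ` fst A)"

text \<open>The extension of \<open>\<omega>\<close> to translates of prototiles. The union has exactly one member when
  \<open>T\<close> is a translate of a prototile, since the prototile and the translation vector are then
  unique; see \<open>subst_tile_shift\<close> below.\<close>

definition subst_tile ::
  "('n::finite, 'l) tile set \<Rightarrow> (real ^ 'n \<Rightarrow> real ^ 'n) \<Rightarrow> (('n, 'l) tile \<Rightarrow> ('n, 'l) tile set)
    \<Rightarrow> ('n, 'l) tile \<Rightarrow> ('n, 'l) tile set" where
  "subst_tile \<A> \<phi> \<omega> T = \<Union> {shift (\<phi> x) (\<omega> A) | x A. A \<in> \<A> \<and> T = shift_tile x A}"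

definition subst ::
  "('n::finite, 'l) tile set \<Rightarrow> (real ^ 'n \<Rightarrow> real ^ 'n) \<Rightarrow> (('n, 'l) tile \<Rightarrow> ('n, 'l) tile set)
    \<Rightarrow> ('n, 'l) tile set \<Rightarrow> ('n, 'l) tile set" where
  "subst \<A> \<phi> \<omega> P = (\<Union>T\<in>P. subst_tile \<A> \<phi> \<omega> T)"

lemma shift_tile_inj:
  fixes A :: "('n::finite, 'l) tile"
  assumes "is_tile A" "shift_tile x A = shift_tile y A"
  shows "x = y"
proof (rule ccontr)
  assume "x \<noteq> y"
  define v where "v = x - y"
  have v: "v \<noteq> 0" using \<open>x \<noteq> y\<close> by (simp add: v_def)
  have step: "z + v \<in> fst A" if "z \<in> fst A" for z
  proof -
    have "z + x \<in> (\<lambda>t. t + y) ` fst A"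
      using assms(2) that by (auto simp: shift_tile_def)
    then obtain w where "w \<in> fst A" "z + x = w + y" by auto
    then have "w = z + v" by (simp add: v_def algebra_simps)
    then show ?thesis using \<open>w \<in> fst A\<close> by simp
  qed
  have cmp: "compact (fst A)" and ne: "fst A \<noteq> {}" using assms(1) by (auto simp: is_tile_def)
  have "continuous_on (fst A) (\<lambda>z. z \<bullet> v)" by (intro continuous_intros)
  then obtain z where z: "z \<in> fst A" "\<And>w. w \<in> fst A \<Longrightarrow> w \<bullet> v \<le> z \<bullet> v"
    using continuous_attains_sup[OF cmp ne] by blast
  have "(z + v) \<bullet> v \<le> z \<bullet> v" using z step by blast
  then show False using v by (simp add: inner_add_left)
      (metis inner_gt_zero_iff not_less)
qed

lemma subst_tile_shift:
  assumes "tile_substitution \<A> \<phi> \<omega>" "A \<in> \<A>"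
  shows "subst_tile \<A> \<phi> \<omega> (shift_tile x A) = shift (\<phi> x) (\<omega> A)"
proof -
  have "B = A \<and> y = x" if "B \<in> \<A>" "shift_tile x A = shift_tile y B" for y B
  proof -
    have "B = shift_tile (- y) (shift_tile y B)"
      by (simp add: shift_tile_def image_image)
    also have "\<dots> = shift_tile (x - y) A"
      by (simp add: that(2)[symmetric]) (simp add: shift_tile_def image_image add_diff_eq)
    finally have "B = A" using assms that(1) unfolding tile_substitution_def prototile_set_def by metis
    then show ?thesis
      using shift_tile_inj that assms unfolding tile_substitution_def prototile_set_def by metis
  qed
  then have "{shift (\<phi> y) (\<omega> B) | y B. B \<in> \<A> \<and> shift_tile x A = shift_tile y B}
      = {shift (\<phi> x) (\<omega> A)}"
    using assms(2) by blast
  then show ?thesis by (simp add: subst_tile_def)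
qed

definition legal ::
  "('n::finite, 'l) tile set \<Rightarrow> (real ^ 'n \<Rightarrow> real ^ 'n) \<Rightarrow> (('n, 'l) tile \<Rightarrow> ('n, 'l) tile set)
    \<Rightarrow> ('n, 'l) tile set \<Rightarrow> bool" where
  "legal \<A> \<phi> \<omega> P \<longleftrightarrow>
     patch P \<and> (\<exists>n\<ge>1. \<exists>A\<in>\<A>. \<exists>x. shift x P \<subseteq> (subst \<A> \<phi> \<omega> ^^ n) {A})"

definition tiling_space ::
  "('n::finite, 'l) tile set \<Rightarrow> (real ^ 'n \<Rightarrow> real ^ 'n) \<Rightarrow> (('n, 'l) tile \<Rightarrow> ('n, 'l) tile set)
    \<Rightarrow> ('n, 'l) tile set set" where
  "tiling_space \<A> \<phi> \<omega> = {T. tiling T \<and> (\<forall>P. finite P \<and> P \<subseteq> T \<longrightarrow> legal \<A> \<phi> \<omega> P)}"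

definition admissible ::
  "('n::finite, 'l) tile set \<Rightarrow> (real ^ 'n \<Rightarrow> real ^ 'n) \<Rightarrow> (('n, 'l) tile \<Rightarrow> ('n, 'l) tile set) \<Rightarrow> bool" where
  "admissible \<A> \<phi> \<omega> \<longleftrightarrow> (\<forall>A\<in>\<A>. \<exists>T\<in>tiling_space \<A> \<phi> \<omega>. A \<in> T)"

definition translation_equiv :: "(('n::finite, 'l) tile set \<times> ('n, 'l) tile set) set" where
  "translation_equiv = {(P, Q). \<exists>x. Q = shift x P}"

definition FPC ::
  "('n::finite, 'l) tile set \<Rightarrow> (real ^ 'n \<Rightarrow> real ^ 'n) \<Rightarrow> (('n, 'l) tile \<Rightarrow> ('n, 'l) tile set) \<Rightarrow> bool" where
  "FPC \<A> \<phi> \<omega> \<longleftrightarrow>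
     (\<forall>R>0. finite ({P. finite P \<and> (\<exists>T\<in>tiling_space \<A> \<phi> \<omega>. P \<subseteq> T) \<and> diameter (support P) < R}
                    // translation_equiv))"

definition non_periodic ::
  "('n::finite, 'l) tile set \<Rightarrow> (real ^ 'n \<Rightarrow> real ^ 'n) \<Rightarrow> (('n, 'l) tile \<Rightarrow> ('n, 'l) tile set) \<Rightarrow> bool" where
  "non_periodic \<A> \<phi> \<omega> \<longleftrightarrow>
     (\<forall>T\<in>tiling_space \<A> \<phi> \<omega>. \<forall>v. shift v T = T \<longrightarrow> v = 0)"

end

(* Write W for the substitution on the space X of tilings. W is onto X by compactness, so if W is
   injective a period v of a tiling pulls back to periods phi^(-k) v of other tilings, which are
   eventually too short unless v = 0.

   Conversely, let W be non-periodic. Repulsion: for some radius rho, no tiling S admits a level k and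
   a vector 0 < |v| <= 1 such that W^k S and W^k (S + v) coincide on phi^k of a ball of radius rho.
   Otherwise take for each rho a witness (S, v) of least level k(rho). By compactness k(rho) tends to
   infinity. By pigeonhole two radii rho1 < rho2 have the same finite set of local patterns in the
   witnessing balls and nearby vectors v1, v2. Agreement is a local property, so v1 is also a period
   of S2 at level k(rho2), and so is the short vector v2 - v1. Applying W finitely often stretches it
   and lowers the level, against the minimality of k(rho2); if v1 = v2, then level k(rho1) would
   already do.

   By repulsion, the offsets at which two given local patterns become indistinguishable under W^n are
   1-separated. They increase with n and lie in a bounded set, so they are constant from some n on.
   Then W^(n+1) S = W^(n+1) S' implies W^n S = W^n S', and W is injective since W^n is onto. *)
theory Submission
  imports Defs "HOL-Computational_Algebra.Fundamental_Theorem_Algebra" "HOL-Library.Diagonal_Subsequence"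
begin

section \<open>Linear algebra: from complex eigenvalues to growth of norms\<close>

subsection \<open>Expansive linear maps\<close>

lemma contracting_recurrence_tendsto_0:
  fixes x y :: "nat \<Rightarrow> real"
  assumes c: "0 \<le> c" "c < 1" and x: "\<And>n. 0 \<le> x n" "\<And>n. x (Suc n) \<le> c * x n + y n"
    and y: "y \<longlonglongrightarrow> 0"
  shows "x \<longlonglongrightarrow> 0"
proof (rule LIMSEQ_I)
  fix e :: real assume e: "0 < e"
  \<comment> \<open>With this \<open>d\<close>, the value \<open>e/2\<close> is the fixed point of t
    -> c * t + d, so the bound \<open>bd\<close> survives each step of the recurrence.\<close>
  define d where "d = (1 - c) * (e/2)"
  have "0 < d" using c e by (simp add: d_def)
  then obtain N where N: "\<And>n. n \<ge> N \<Longrightarrow> \<bar>y n\<bar> < d"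
    using LIMSEQ_D[OF y, of d] by auto
  have bd: "x (N + k) \<le> c ^ k * x N + e/2" for k
  proof (induction k)
    case (Suc k)
    have "x (N + Suc k) \<le> c * x (N + k) + d"
      using x(2)[of "N + k"] N[of "N + k"] by simp
    also have "\<dots> \<le> c * (c ^ k * x N + e/2) + d"
      using Suc c by (simp add: mult_left_mono)
    also have "\<dots> = c ^ Suc k * x N + e/2" by (simp add: d_def field_simps)
    finally show ?case .
  qed (use e in simp)
  have "(\<lambda>k. c ^ k * x N) \<longlonglongrightarrow> 0"
    using tendsto_mult_left_zero[OF LIMSEQ_power_zero, of c "x N"] c by simp
  from LIMSEQ_D[OF this, of "e/2"] e obtain K where K: "\<And>k. k \<ge> K \<Longrightarrow> \<bar>c ^ k * x N\<bar> < e/2"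
    by auto
  show "\<exists>no. \<forall>n\<ge>no. norm (x n - 0) < e"
  proof (intro exI[of _ "N + K"] allI impI)
    fix n assume "n \<ge> N + K"
    then obtain k where "n = N + k" "k \<ge> K" by (metis add.assoc le_Suc_ex le_add1)
    then show "norm (x n - 0) < e" using bd[of k] K[of k] x(1)[of n] by simp
  qed
qed

text \<open>The vector p(N) v in Horner form, so that only products of a matrix with a vector
  occur.\<close>

definition poly_act :: "complex ^ 'n ^ 'n \<Rightarrow> complex poly \<Rightarrow> complex ^ 'n \<Rightarrow> complex ^ 'n::finite" where
  "poly_act N p v = fold_coeffs (\<lambda>a w. a *s v + N *v w) p 0"

lemma poly_act_0 [simp]: "poly_act N 0 v = 0"
  by (simp add: poly_act_def)

lemma poly_act_pCons [simp]: "poly_act N (pCons a p) v = a *s v + N *v poly_act N p v"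
  by (cases "p = 0 \<and> a = 0") (auto simp: poly_act_def)

lemma poly_act_add: "poly_act N (p + q) v = poly_act N p v + poly_act N q v"
  by (induction p q rule: poly_induct2)
    (auto simp: matrix_vector_right_distrib vector_sadd_rdistrib)

lemma poly_act_smult: "poly_act N (smult c p) v = c *s poly_act N p v"
  by (induction p)
    (auto simp: vector_scalar_commute vector_add_ldistrib)

lemma poly_act_vec_scale: "poly_act N p (c *s v) = c *s poly_act N p v"
  by (induction p)
    (auto simp: vector_scalar_commute vector_add_ldistrib mult.commute)

lemma poly_act_vec_add: "poly_act N p (v + w) = poly_act N p v + poly_act N p w"
  by (induction p)
    (auto simp: vector_add_ldistrib matrix_vector_right_distrib)

lemma poly_act_commute: "poly_act N p (N *v v) = N *v poly_act N p v"
  by (induction p)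
    (auto simp: matrix_vector_right_distrib vector_scalar_commute)

lemma poly_act_monom: "poly_act N (monom a i) v = a *s (((*v) N) ^^ i) v"
  by (induction i) (auto simp: monom_0 monom_Suc vector_scalar_commute)

lemma poly_act_sum: "poly_act N (\<Sum>i\<in>I. p i) v = (\<Sum>i\<in>I. poly_act N (p i) v)"
  by (induction I rule: infinite_finite_induct) (auto simp: poly_act_add)

text \<open>\<open>DIM\<close> is the real dimension here, so one iterate more than that forces a
  real linear relation among v, N v, N^2 v, ..., and its coefficients form p. If two of these
  iterates coincide, a difference of two monomials serves.\<close>

lemma exists_annihilating_poly:
  fixes N :: "complex ^ 'n ^ 'n::finite"
  shows "\<exists>p. p \<noteq> 0 \<and> poly_act N p v = 0"
proof -
  let ?g = "\<lambda>i. (((*v) N) ^^ i) v" and ?I = "{..DIM(complex ^ 'n)}"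
  show ?thesis
  proof (cases "inj_on ?g ?I")
    case True
    then have "card (?g ` ?I) > DIM(complex ^ 'n)" by (simp add: card_image)
    then have "dependent (?g ` ?I)" by (intro dependent_biggerset) auto
    then obtain u where u: "\<exists>x\<in>?g ` ?I. u x \<noteq> 0" "(\<Sum>x\<in>?g ` ?I. u x *\<^sub>R x) = 0"
      using dependent_finite[of "?g ` ?I"] by auto
    define p where "p = (\<Sum>i\<in>?I. monom (complex_of_real (u (?g i))) i)"
    have "poly_act N p v = (\<Sum>i\<in>?I. u (?g i) *\<^sub>R ?g i)"
      unfolding p_def poly_act_sum poly_act_monom
      by (rule sum.cong[OF refl])
        (simp only: vec_eq_iff vector_scaleR_component vector_smult_component, simp add: scaleR_conv_of_real)
    also have "\<dots> = 0" using u(2) unfolding sum.reindex[OF True] comp_def .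
    finally have "poly_act N p v = 0" .
    moreover obtain j where j: "j \<in> ?I" "u (?g j) \<noteq> 0" using u(1) by auto
    have "coeff p j = u (?g j)"
      using j(1) by (simp add: p_def coeff_sum if_distrib sum.delta cong: if_cong)
    then have "p \<noteq> 0" using j by auto
    ultimately show ?thesis by blast
  next
    case False
    then obtain i j where ij: "i \<noteq> j" "?g i = ?g j" by (auto simp: inj_on_def)
    have "poly_act N (monom 1 i + smult (-1) (monom 1 j)) v = 0"
      unfolding poly_act_add poly_act_smult poly_act_monom using ij(2)
      by (simp add: vec_eq_iff)
    moreover have "coeff (monom (1::complex) i + smult (-1) (monom 1 j)) i \<noteq> 0"
      using ij(1) by simp
    ultimately show ?thesis by (metis coeff_0)
  qed
qed

text \<open>Induction on the degree of a polynomial that annihilates v, in place of a Jordan normal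
  form. Split off a root \<open>\<mu>\<close> with quotient q. Either q already kills v, or q(N) v
  is an eigenvector and so \<open>\<mu>\<close> has modulus below 1; then q kills (N -
  \<open>\<mu>\<close>) v, and the coordinates of the iterates of v obey a contracting
  recurrence.\<close>

lemma spectral_radius_less_1_iterates_tendsto_0:
  fixes N :: "complex ^ 'n ^ 'n::finite"
  assumes ev: "\<And>\<mu> v. v \<noteq> 0 \<Longrightarrow> N *v v = \<mu> *s v \<Longrightarrow> norm \<mu> < 1"
  shows "(\<lambda>n. (((*v) N) ^^ n) v) \<longlonglongrightarrow> 0"
proof -
  have main: "p \<noteq> 0 \<Longrightarrow> poly_act N p v = 0 \<Longrightarrow> (\<lambda>n. (((*v) N) ^^ n) v) \<longlonglongrightarrow> 0" for p v
  proof (induction "degree p" arbitrary: p v)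
    case 0
    then obtain a where "p = [:a:]" "a \<noteq> 0" by (metis degree_eq_zeroE pCons_0_0)
    then have "v = 0" using 0 by (simp add: vec_eq_iff)
    have "(((*v) N) ^^ n) 0 = 0" for n by (induction n) auto
    then show ?case by (simp add: \<open>v = 0\<close>)
  next
    case (Suc d)
    have "\<not> constant (poly p)" using Suc(2) constant_degree[of p] by simp
    then obtain \<mu> where "poly p \<mu> = 0" using fundamental_theorem_of_algebra by blast
    then obtain q where q: "p = [:-\<mu>, 1:] * q" by (auto simp: poly_eq_0_iff_dvd elim: dvdE)
    have q0: "q \<noteq> 0" using q Suc.prems by auto
    then have dq: "d = degree q" using Suc(2) q by (simp add: degree_mult_eq del: mult_pCons_left)
    have pq: "p = pCons 0 q + smult (-\<mu>) q" using q by simp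
    have e1: "N *v poly_act N q v = \<mu> *s poly_act N q v"
      using Suc.prems(2) unfolding pq poly_act_add poly_act_smult by (simp add: vec_eq_iff)
    let ?w = "N *v v + (-\<mu>) *s v"
    have e2: "poly_act N q ?w = 0"
      unfolding poly_act_vec_add poly_act_vec_scale poly_act_commute e1 by (simp add: vec_eq_iff)
    show ?case
    proof (cases "poly_act N q v = 0")
      case True
      then show ?thesis using Suc(1)[OF dq q0] by blast
    next
      case False
      then have mu: "norm \<mu> < 1" using ev e1 by blast
      have w: "(\<lambda>n. (((*v) N) ^^ n) ?w) \<longlonglongrightarrow> 0" using Suc(1)[OF dq q0 e2] .
      have iter: "(((*v) N) ^^ n) ?w = (((*v) N) ^^ Suc n) v + (-\<mu>) *s (((*v) N) ^^ n) v" for n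
      proof (induction n)
        case (Suc n)
        have "(((*v) N) ^^ Suc n) ?w = N *v ((((*v) N) ^^ Suc n) v + (-\<mu>) *s (((*v) N) ^^ n) v)"
          using Suc by simp
        then show ?case by (simp only: matrix_vector_right_distrib vector_scalar_commute funpow.simps comp_apply)
      qed simp
      show ?thesis
      proof (rule vec_tendstoI)
        fix i
        have "(\<lambda>n. norm (((((*v) N) ^^ n) ?w) $ i)) \<longlonglongrightarrow> 0"
          using tendsto_norm[OF tendsto_vec_nth[OF w, of i]] by simp
        moreover have "norm (((((*v) N) ^^ Suc n) v) $ i)
            \<le> norm \<mu> * norm (((((*v) N) ^^ n) v) $ i) + norm (((((*v) N) ^^ n) ?w) $ i)" for n
        proof -
          have "((((*v) N) ^^ Suc n) v) $ i = \<mu> * ((((*v) N) ^^ n) v) $ i + ((((*v) N) ^^ n) ?w) $ i"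
            unfolding iter by simp
          then show ?thesis by (metis norm_mult norm_triangle_ineq)
        qed
        ultimately have "(\<lambda>n. norm (((((*v) N) ^^ n) v) $ i)) \<longlonglongrightarrow> 0"
          using contracting_recurrence_tendsto_0[of "norm \<mu>" "\<lambda>n. norm (((((*v) N) ^^ n) v) $ i)"
              "\<lambda>n. norm (((((*v) N) ^^ n) ?w) $ i)"] mu norm_ge_zero by blast
        then show "(\<lambda>n. ((((*v) N) ^^ n) v) $ i) \<longlonglongrightarrow> 0 $ i"
          using tendsto_norm_zero_cancel by simp
      qed
    qed
  qed
  show ?thesis using exists_annihilating_poly main by blast
qed

lemma linear_funpow:
  fixes f :: "'a::real_vector \<Rightarrow> 'a"
  shows "linear f \<Longrightarrow> linear (f ^^ n)"
proof (induction n)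
  case (Suc n)
  then show ?case using linear_compose[of "f ^^ n" f] by (simp add: comp_def)
qed (simp add: linear_iff)

text \<open>The complexified matrix M does not have eigenvalue 0, and all eigenvalues of its inverse
  lie in the open unit disc. Hence the iterates of the inverse map tend to 0, and some iterate at
  least halves every norm.\<close>

lemma expansive_linear_inj_expanding:
  fixes \<phi> :: "real ^ 'n::finite \<Rightarrow> real ^ 'n"
  assumes "expansive \<phi>" shows "linear \<phi>" "inj \<phi>"
    "\<exists>m\<ge>1. \<forall>x. 2 * norm x \<le> norm ((\<phi> ^^ m) x)"
proof -
  show lin: "linear \<phi>" using assms by (simp add: expansive_def)
  define cv :: "real ^ 'n \<Rightarrow> complex ^ 'n" where "cv x = (\<chi> i. complex_of_real (x $ i))" for x
  define M :: "complex ^ 'n ^ 'n" where "M = (\<chi> i j. complex_of_real (matrix \<phi> $ i $ j))"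
  have ev: "norm c > 1" if "v \<noteq> 0" "M *v v = c *s v" for v c
    using assms that unfolding expansive_def complex_eigenvalue_def M_def by blast
  have "M *v v = 0 \<Longrightarrow> v = 0" for v using ev[of v 0] by (auto simp: vec_eq_iff)
  then obtain N where N: "N ** M = mat 1" by (metis matrix_left_invertible_ker)
  then have N': "M ** N = mat 1" by (simp add: matrix_left_right_inverse)
  have MN: "N *v (M *v v) = v" "M *v (N *v v) = v" for v
    by (simp_all add: matrix_vector_mul_assoc N N')
  have cvM: "M *v cv x = cv (\<phi> x)" for x
  proof -
    have "\<phi> x = matrix \<phi> *v x" using lin by (simp add: matrix_works linear_matrix_vector_mul_eq)
    then show ?thesis by (simp add: M_def cv_def matrix_vector_mult_def vec_eq_iff)
  qed
  have cv0: "cv x = 0 \<longleftrightarrow> x = 0" for x by (simp add: cv_def vec_eq_iff)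
  have "x = 0" if "\<phi> x = 0" for x using MN(1)[of "cv x"] that cv0[of x] cv0[of 0] by (simp add: cvM)
  then show inj: "inj \<phi>" using lin by (simp add: linear_injective_0)
  have Nev: "norm \<mu> < 1" if "v \<noteq> 0" "N *v v = \<mu> *s v" for \<mu> v
  proof -
    have eq: "v = \<mu> *s (M *v v)" using MN(2)[of v] that(2) by (simp add: vector_scalar_commute)
    then have "\<mu> \<noteq> 0" using that(1) by (auto simp: vec_eq_iff)
    then have "M *v v = (1/\<mu>) *s v" by (subst (2) eq) (simp add: vector_smult_assoc)
    then have "norm (1/\<mu>) > 1" using ev that(1) by blast
    then show ?thesis by (simp add: norm_divide divide_simps split: if_splits)
  qed
  obtain \<psi> where psi: "linear \<psi>" "\<psi> \<circ> \<phi> = id"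
    using linear_injective_left_inverse[OF lin inj] by blast
  have psi': "\<phi> (\<psi> x) = x" for x
    using linear_inverse_left[OF lin psi(1)] psi(2) by (metis comp_apply id_apply)
  have "cv (\<psi> x) = N *v cv x" for x using MN(1)[of "cv (\<psi> x)"] by (simp add: cvM psi')
  then have it: "cv ((\<psi> ^^ n) x) = (((*v) N) ^^ n) (cv x)" for n x by (induction n) auto
  have lim: "(\<lambda>n. (\<psi> ^^ n) x) \<longlonglongrightarrow> 0" for x
  proof (rule vec_tendstoI)
    fix i
    have "(\<lambda>n. cv ((\<psi> ^^ n) x) $ i) \<longlonglongrightarrow> 0 $ i"
      unfolding it by (intro tendsto_vec_nth spectral_radius_less_1_iterates_tendsto_0 Nev)
    then show "(\<lambda>n. (\<psi> ^^ n) x $ i) \<longlonglongrightarrow> 0 $ i"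
      by (auto simp: cv_def dest: tendsto_Re)
  qed
  \<comment> \<open>The sum over the basis bounds the operator norm, so convergence at the finitely
    many basis vectors gives a uniform estimate.\<close>
  have "(\<lambda>n. \<Sum>b\<in>Basis. norm ((\<psi> ^^ n) b)) \<longlonglongrightarrow> (\<Sum>b\<in>(Basis::(real^'n) set). 0)"
    by (intro tendsto_sum tendsto_norm_zero lim)
  then have "\<forall>\<^sub>F n in sequentially. (\<Sum>b\<in>(Basis::(real^'n) set). norm ((\<psi> ^^ n) b)) < 1/2"
    by (intro order_tendstoD(2)) auto
  then obtain n0 where "\<forall>n\<ge>n0. (\<Sum>b\<in>(Basis::(real^'n) set). norm ((\<psi> ^^ n) b)) < 1/2"
    by (auto simp: eventually_sequentially)
  \<comment> \<open>Positivity of \<open>m\<close> is what makes a level strictly drop in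
    \<open>repulsion\<close>.\<close>
  then obtain m where m: "m \<ge> 1" "(\<Sum>b\<in>(Basis::(real^'n) set). norm ((\<psi> ^^ m) b)) < 1/2"
    by (metis le_add1 le_add2)
  have small: "norm ((\<psi> ^^ m) x) \<le> norm x / 2" for x
  proof -
    have l: "linear (\<psi> ^^ m)" using psi(1) by (rule linear_funpow)
    have "(\<psi> ^^ m) x = (\<psi> ^^ m) (\<Sum>b\<in>Basis. (x \<bullet> b) *\<^sub>R b)" by (simp add: euclidean_representation)
    also have "\<dots> = (\<Sum>b\<in>Basis. (x \<bullet> b) *\<^sub>R (\<psi> ^^ m) b)"
      by (simp add: linear_sum[OF l] linear_cmul[OF l])
    finally have "norm ((\<psi> ^^ m) x) \<le> (\<Sum>b\<in>Basis. norm ((x \<bullet> b) *\<^sub>R (\<psi> ^^ m) b))"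
      by (simp only: norm_sum)
    also have "\<dots> \<le> (\<Sum>b\<in>(Basis::(real^'n) set). norm x * norm ((\<psi> ^^ m) b))"
      by (intro sum_mono) (auto intro!: mult_right_mono Basis_le_norm)
    also have "\<dots> = norm x * (\<Sum>b\<in>(Basis::(real^'n) set). norm ((\<psi> ^^ m) b))" by (simp add: sum_distrib_left)
    also have "\<dots> \<le> norm x * (1/2)" using m(2) by (intro mult_left_mono) auto
    finally show ?thesis by simp
  qed
  have can: "(\<psi> ^^ n) ((\<phi> ^^ n) x) = x" for n x
  proof (induction n arbitrary: x)
    case (Suc n)
    have "(\<psi> ^^ Suc n) ((\<phi> ^^ Suc n) x) = \<psi> ((\<psi> ^^ n) ((\<phi> ^^ n) (\<phi> x)))"
      by (simp add: funpow_swap1)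
    also have "\<dots> = x" using psi(2) by (simp add: Suc pointfree_idE)
    finally show ?case .
  qed simp
  have "2 * norm x \<le> norm ((\<phi> ^^ m) x)" for x
    using small[of "(\<phi> ^^ m) x"] by (simp add: can)
  then show "\<exists>m\<ge>1. \<forall>x. 2 * norm x \<le> norm ((\<phi> ^^ m) x)" using m(1) by blast
qed

section \<open>Geometry of tiles, and the part of a tile set that meets a ball\<close>

subsection \<open>Tiles, overlaps and local patterns\<close>

lemma fst_shift_tile: "fst (shift_tile g t) = (+) g ` fst t"
  by (auto simp: shift_tile_def add.commute)

lemma mem_fst_shift_tile [simp]: "x \<in> fst (shift_tile g t) \<longleftrightarrow> x - g \<in> fst t"
  by (auto simp: shift_tile_def image_iff algebra_simps intro: bexI[of _ "x - g"])

lemma interior_shift_tile: "interior (fst (shift_tile g t)) = (+) g ` interior (fst t)"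
  by (simp add: fst_shift_tile interior_translation)

lemma mem_interior_shift_tile [simp]:
  "x \<in> interior (fst (shift_tile g t)) \<longleftrightarrow> x - g \<in> interior (fst t)"
  by (auto simp: interior_shift_tile image_iff algebra_simps intro: bexI[of _ "x - g"])

lemma shift_tile_shift_tile [simp]: "shift_tile a (shift_tile b t) = shift_tile (a + b) t"
  by (auto simp: shift_tile_def image_image algebra_simps)

lemma shift_tile_0 [simp]: "shift_tile 0 t = t"
  by (simp add: shift_tile_def)

lemma shift_tile_eq_iff [simp]: "shift_tile g s = shift_tile g t \<longleftrightarrow> s = t"
  by (metis add.left_inverse shift_tile_0 shift_tile_shift_tile)

lemma shift_shift [simp]: "shift a (shift b P) = shift (a + b) P"
  by (simp add: shift_def image_image)

lemma shift_0 [simp]: "shift 0 P = P"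
  by (simp add: shift_def)

lemma mem_shift: "t \<in> shift g P \<longleftrightarrow> shift_tile (- g) t \<in> P"
  by (auto simp: shift_def intro!: image_eqI[of _ _ "shift_tile (- g) t"])

lemma shift_mono: "P \<subseteq> Q \<Longrightarrow> shift g P \<subseteq> shift g Q"
  by (auto simp: shift_def)

lemma shift_subset_iff: "shift g P \<subseteq> Q \<longleftrightarrow> P \<subseteq> shift (- g) Q"
  using shift_mono[of "shift g P" Q "- g"] shift_mono[of P "shift (- g) Q" g] by auto

lemma support_shift: "support (shift g P) = (+) g ` support P"
  by (auto simp: support_def shift_def fst_shift_tile)

lemma finite_shift: "finite P \<Longrightarrow> finite (shift g P)"
  by (simp add: shift_def)

lemma is_tile_shift_tile [simp]: "is_tile (shift_tile g t) \<longleftrightarrow> is_tile t"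
proof -
  have *: "is_tile (shift_tile g t)" if "is_tile t" for g and t :: "('a, 'b) tile"
    using that by (simp add: is_tile_def fst_shift_tile interior_translation closure_translation
        compact_translation)
  show ?thesis using *[of t g] *[of "shift_tile g t" "- g"] by auto
qed

definition overlap :: "('n::finite, 'l) tile \<Rightarrow> ('n, 'l) tile \<Rightarrow> bool" where
  "overlap s t \<longleftrightarrow> interior (fst s) \<inter> interior (fst t) \<noteq> {}"

text \<open>Two tile sets never contradict each other. With P = Q this is non-overlapping, and
  between two tilings it amounts to equality. Unlike equality it passes to subsets, so it can
  express agreement on a bounded region.\<close>

definition compat :: "('n::finite, 'l) tile set \<Rightarrow> ('n, 'l) tile set \<Rightarrow> bool" where
  "compat P Q \<longleftrightarrow> (\<forall>s\<in>P. \<forall>t\<in>Q. overlap s t \<longrightarrow> s = t)"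

lemma compatD: "compat P Q \<Longrightarrow> s \<in> P \<Longrightarrow> t \<in> Q \<Longrightarrow> overlap s t \<Longrightarrow> s = t"
  by (auto simp: compat_def)

lemma compat_mono: "compat P Q \<Longrightarrow> P' \<subseteq> P \<Longrightarrow> Q' \<subseteq> Q \<Longrightarrow> compat P' Q'"
  by (auto simp: compat_def)

lemma overlap_sym: "overlap s t \<longleftrightarrow> overlap t s"
  by (auto simp: overlap_def)

lemma compat_sym: "compat P Q \<longleftrightarrow> compat Q P"
  unfolding compat_def using overlap_sym by metis

lemma non_overlapping_iff_compat: "non_overlapping P \<longleftrightarrow> compat P P"
  unfolding non_overlapping_def compat_def overlap_def by blast

lemma overlap_shift_tile [simp]: "overlap (shift_tile g s) (shift_tile g t) \<longleftrightarrow> overlap s t"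
  by (auto simp: overlap_def interior_shift_tile)

lemma compat_shift [simp]: "compat (shift g P) (shift g Q) \<longleftrightarrow> compat P Q"
  by (auto simp: compat_def shift_def)

lemma overlapI: "q \<in> interior (fst s) \<Longrightarrow> q \<in> interior (fst t) \<Longrightarrow> overlap s t"
  by (auto simp: overlap_def)

text \<open>A tile is the closure of its interior, so its boundary points are limits of interior
  points. Thus a covering tile found at an interior point of another tile overlaps it
  properly.\<close>

lemma overlap_boundary:
  assumes "is_tile s" "q \<in> fst s" "q \<in> interior (fst t)"
  shows "overlap s t"
proof -
  have "q \<in> closure (interior (fst s))" using assms by (simp add: is_tile_def)
  then show ?thesis
    using closure_iff_nhds_not_empty[of q "interior (fst s)"] assms(3)
    unfolding overlap_def by (metis inf_commute open_interior subset_refl)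
qed

lemma is_tile_interior_ne: "is_tile t \<Longrightarrow> interior (fst t) \<noteq> {}"
  unfolding is_tile_def by (metis closure_empty)

lemma overlap_refl: "is_tile t \<Longrightarrow> overlap t t"
  by (simp add: overlap_def is_tile_interior_ne)

lemma tiling_cover: "tiling T \<Longrightarrow> \<exists>t\<in>T. q \<in> fst t"
  by (auto simp: tiling_def support_def)

lemma tiling_compat: "tiling T \<Longrightarrow> P \<subseteq> T \<Longrightarrow> Q \<subseteq> T \<Longrightarrow> compat P Q"
  by (metis compat_mono non_overlapping_iff_compat tiling_def)

text \<open>An interior point of a tile of T is covered by some tile of T', which overlaps the first
  and so equals it.\<close>

lemma tiling_subset_compat:
  assumes "tiling T" "tiling T'" "compat T T'"
  shows "T \<subseteq> T'"
proof
  fix t assume t: "t \<in> T"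
  then have "is_tile t" using assms by (auto simp: tiling_def)
  then obtain q where q: "q \<in> interior (fst t)" using is_tile_interior_ne by blast
  obtain t' where t': "t' \<in> T'" "q \<in> fst t'" using tiling_cover[OF assms(2)] by blast
  then have "overlap t' t" using q assms(2) overlap_boundary unfolding tiling_def by blast
  then show "t \<in> T'" using compatD[OF assms(3) t t'(1)] t'(1) overlap_sym by blast
qed

lemma tiling_eq_compat:
  assumes "tiling T" "tiling T'" "compat T T'" shows "T = T'"
  using tiling_subset_compat assms compat_sym by (metis subset_antisym)

lemma tiling_eq_subset:
  assumes "tiling T" "tiling T'" "T \<subseteq> T'" shows "T = T'"
  using assms tiling_eq_compat tiling_compat by blast

lemma tiling_shift: "tiling T \<Longrightarrow> tiling (shift g T)"
  unfolding tiling_def non_overlapping_iff_compat support_shift compat_shift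
  by (auto simp: shift_def surj_plus)

text \<open>For r = 0 these are the tiles containing p. For negative r there are none, so radii can
  be reduced without side conditions.\<close>

definition near :: "('n::finite, 'l) tile set \<Rightarrow> real ^ 'n \<Rightarrow> real \<Rightarrow> ('n, 'l) tile set" where
  "near P p r = {t \<in> P. fst t \<inter> cball p r \<noteq> {}}"

lemma near_subset: "near P p r \<subseteq> P"
  by (auto simp: near_def)

lemma near_mono: "r \<le> r' \<Longrightarrow> near P p r \<subseteq> near P p r'"
  by (auto simp: near_def)

lemma near_move: "dist p q + r \<le> r' \<Longrightarrow> near P p r \<subseteq> near P q r'"
proof -
  assume a: "dist p q + r \<le> r'"
  have "cball p r \<subseteq> cball q r'"
    using a by (simp add: subset_iff) (metis add_left_mono dist_commute dist_triangle order_trans)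
  then show ?thesis by (auto simp: near_def)
qed

lemma near_near: "dist p q + r \<le> r' \<Longrightarrow> near (near P q r') p r = near P p r"
  using near_move[of p q r r' P] by (auto simp: near_def)

lemma near_eqD: "near P q r' = near Q q r' \<Longrightarrow> dist p q + r \<le> r' \<Longrightarrow> near P p r = near Q p r"
  using near_near by metis

lemma near_shift: "near (shift g P) (p + g) r = shift g (near P p r)"
proof -
  have "(+) g ` fst t \<inter> cball (p + g) r \<noteq> {} \<longleftrightarrow> fst t \<inter> cball p r \<noteq> {}" for t :: "('a, 'b) tile"
  proof -
    have "cball (p + g) r = (+) g ` cball p r" by (simp only: image_add_cball add.commute)
    then show ?thesis by (metis image_Int image_is_empty inj_on_add)
  qed
  then have "fst (shift_tile g t) \<inter> cball (p + g) r \<noteq> {} \<longleftrightarrow> fst t \<inter> cball p r \<noteq> {}"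
    for t :: "('a, 'b) tile" by (simp only: fst_shift_tile)
  then show ?thesis unfolding near_def shift_def by blast
qed

lemma near_shift': "near (shift g P) p r = shift g (near P (p - g) r)"
  using near_shift[of g P "p - g" r] by simp

text \<open>Otherwise there is a limit point, and its ball of radius \<open>e/2\<close> contains two
  distinct points of the set.\<close>

lemma finite_bounded_separated:
  fixes C :: "'a::euclidean_space set"
  assumes "bounded C" "e > 0" "\<And>x y. x \<in> C \<Longrightarrow> y \<in> C \<Longrightarrow> dist x y < e \<Longrightarrow> x = y"
  shows "finite C"
proof (rule ccontr)
  assume "infinite C"
  then obtain l where l: "l islimpt C"
    using bounded_infinite_imp_islimpt[OF subset_refl assms(1)] by blast
  have "infinite (C \<inter> ball l (e/2))"
    using l assms(2) by (simp add: islimpt_eq_infinite_ball)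
  then obtain x y where "x \<in> C \<inter> ball l (e/2)" "y \<in> C \<inter> ball l (e/2)" "x \<noteq> y"
    by (metis finite.emptyI finite_insert finite_subset insertCI subsetI singletonD)
  moreover from this have "dist x y < e"
    using dist_triangle_half_l[of x l e y] by (simp add: dist_commute)
  ultimately show False using assms(3) by blast
qed

lemma finite_range_constant_subseq:
  fixes f :: "nat \<Rightarrow> 'a"
  assumes "finite (range f)"
  shows "\<exists>r c. strict_mono (r :: nat \<Rightarrow> nat) \<and> (\<forall>n. f (r n) = c)"
proof -
  obtain a where "infinite {n \<in> UNIV. f n = f a}"
    using pigeonhole_infinite[of "UNIV :: nat set" f] assms by auto
  from infinite_enumerate[OF this] show ?thesis by auto
qed

section \<open>The substitution as a map on sets of tiles, and its tiling space\<close>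

subsection \<open>Iterating a tile substitution\<close>

locale tile_subst =
  fixes \<A> :: "('n::finite, 'l::finite) tile set"
    and \<phi> :: "real ^ 'n \<Rightarrow> real ^ 'n"
    and \<omega> :: "('n, 'l) tile \<Rightarrow> ('n, 'l) tile set"
  assumes tsub: "tile_substitution \<A> \<phi> \<omega>"
    and adm: "admissible \<A> \<phi> \<omega>"
    and fpc: "FPC \<A> \<phi> \<omega>"
begin

abbreviation W where "W \<equiv> subst \<A> \<phi> \<omega>"
abbreviation X where "X \<equiv> tiling_space \<A> \<phi> \<omega>"

definition tiles :: "('n, 'l) tile set" where
  "tiles = {shift_tile x A | x A. A \<in> \<A>}"

text \<open>The place to which the origin of the prototile is moved. By \<open>ctr_unique\<close>
  the choice is forced.\<close>

definition ctr :: "('n, 'l) tile \<Rightarrow> real ^ 'n" where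
  "ctr t = (SOME x. \<exists>A\<in>\<A>. t = shift_tile x A)"

lemma proto: "prototile_set \<A>" and finite_protos: "finite \<A>"
  using tsub by (auto simp: tile_substitution_def prototile_set_def)

lemma expansive_phi: "expansive \<phi>"
  using tsub by (auto simp: tile_substitution_def)

lemma linear_phi: "linear \<phi>" and inj_phi: "inj \<phi>"
  using expansive_linear_inj_expanding[OF expansive_phi] by auto

lemma surj_phi: "surj \<phi>"
  using linear_phi inj_phi by (simp add: linear_injective_imp_surjective)

lemma linear_pow: "linear (\<phi> ^^ k)"
  using linear_phi by (rule linear_funpow)

lemma inj_pow: "inj (\<phi> ^^ k)"
  using inj_phi by simp

lemma surj_pow: "surj (\<phi> ^^ k)"
  using surj_phi by (rule surj_fn)

lemma phi_simps: "\<phi> (x + y) = \<phi> x + \<phi> y" "\<phi> (x - y) = \<phi> x - \<phi> y" "\<phi> (- x) = - \<phi> x" "\<phi> 0 = 0"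
  using linear_phi by (simp_all add: linear_add linear_diff linear_neg linear_0)

lemma pow_simps: "(\<phi> ^^ k) (x + y) = (\<phi> ^^ k) x + (\<phi> ^^ k) y"
    "(\<phi> ^^ k) (x - y) = (\<phi> ^^ k) x - (\<phi> ^^ k) y" "(\<phi> ^^ k) 0 = 0"
  using linear_pow[of k] by (simp_all add: linear_add linear_diff linear_0)

lemma pow_eq_0: "(\<phi> ^^ k) x = 0 \<longleftrightarrow> x = 0"
  using inj_pow[of k] pow_simps(3)[of k] by (metis injD)

lemma ctr: "t \<in> tiles \<Longrightarrow> \<exists>A\<in>\<A>. t = shift_tile (ctr t) A"
  unfolding ctr_def tiles_def by (rule someI_ex) auto

lemma ctr_proto: "t \<in> tiles \<Longrightarrow> shift_tile (- ctr t) t \<in> \<A>"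
  using ctr[of t] by (metis add.left_inverse shift_tile_0 shift_tile_shift_tile)

lemma proto_tiles: "A \<in> \<A> \<Longrightarrow> A \<in> tiles"
  unfolding tiles_def by (metis (mono_tags, lifting) mem_Collect_eq shift_tile_0)

lemma proto_is_tile: "A \<in> \<A> \<Longrightarrow> is_tile A" and proto_0: "A \<in> \<A> \<Longrightarrow> 0 \<in> interior (fst A)"
  using proto by (auto simp: prototile_set_def)

lemma tiles_is_tile: "t \<in> tiles \<Longrightarrow> is_tile t"
  unfolding tiles_def using proto_is_tile by auto

lemma tiles_shift [simp]: "shift_tile g t \<in> tiles \<longleftrightarrow> t \<in> tiles"
proof
  have *: "shift_tile g t \<in> tiles" if "t \<in> tiles" for g t
  proof -
    from that obtain x A where A: "A \<in> \<A>" "t = shift_tile x A" unfolding tiles_def by blast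
    then have "shift_tile g t = shift_tile (g + x) A" by simp
    then show ?thesis using A(1) unfolding tiles_def by blast
  qed
  show "t \<in> tiles \<Longrightarrow> shift_tile g t \<in> tiles" by (rule *)
  show "shift_tile g t \<in> tiles \<Longrightarrow> t \<in> tiles"
    using *[of "shift_tile g t" "- g"] by simp
qed

lemma ctr_interior: "t \<in> tiles \<Longrightarrow> ctr t \<in> interior (fst t)"
  using ctr proto_0 by (metis diff_self mem_interior_shift_tile)

lemma ctr_in: "t \<in> tiles \<Longrightarrow> ctr t \<in> fst t"
  using ctr_interior interior_subset by blast

section \<open>Uniform outer and inner radii of the tiles\<close>

lemma ex_radius: "\<exists>D>0. \<forall>A\<in>\<A>. fst A \<subseteq> cball 0 D"
proof -
  have "bounded (\<Union>A\<in>\<A>. fst A)"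
    using finite_protos proto_is_tile by (intro bounded_UN) (auto simp: is_tile_def compact_imp_bounded)
  then obtain D where "D > 0" "(\<Union>A\<in>\<A>. fst A) \<subseteq> cball 0 D"
    by (metis bounded_pos mem_cball_0 subsetI)
  then show ?thesis by blast
qed

definition rad :: real where "rad = (SOME D. D > 0 \<and> (\<forall>A\<in>\<A>. fst A \<subseteq> cball 0 D))"

lemma rad: "rad > 0" "A \<in> \<A> \<Longrightarrow> fst A \<subseteq> cball 0 rad"
  using someI_ex[OF ex_radius] unfolding rad_def by auto

lemma ex_core: "\<exists>d>0. \<forall>A\<in>\<A>. ball 0 d \<subseteq> interior (fst A)"
proof -
  have "open (\<Inter>A\<in>\<A>. interior (fst A))" using finite_protos by auto
  moreover have "0 \<in> (\<Inter>A\<in>\<A>. interior (fst A))" using proto_0 by auto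
  ultimately obtain d where "d > 0" "ball 0 d \<subseteq> (\<Inter>A\<in>\<A>. interior (fst A))"
    by (meson open_contains_ball)
  then show ?thesis by blast
qed

text \<open>A common inner radius. Tiles with centres less than \<open>core\<close> apart overlap,
  so the centres in a tiling are uniformly separated.\<close>

definition core :: real where "core = (SOME d. d > 0 \<and> (\<forall>A\<in>\<A>. ball 0 d \<subseteq> interior (fst A)))"

lemma core: "core > 0" "A \<in> \<A> \<Longrightarrow> ball 0 core \<subseteq> interior (fst A)"
  using someI_ex[OF ex_core] unfolding core_def by auto

lemma tile_rad: "t \<in> tiles \<Longrightarrow> x \<in> fst t \<Longrightarrow> dist (ctr t) x \<le> rad"
proof -
  assume t: "t \<in> tiles" and x: "x \<in> fst t"
  from ctr[OF t] obtain A where A: "A \<in> \<A>" "t = shift_tile (ctr t) A" by blast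
  then have "x - ctr t \<in> fst A" using x by (metis mem_fst_shift_tile)
  then have "norm (x - ctr t) \<le> rad" using rad(2)[OF A(1)] by auto
  then show ?thesis by (simp add: dist_norm norm_minus_commute)
qed

lemma tile_diam: "t \<in> tiles \<Longrightarrow> x \<in> fst t \<Longrightarrow> y \<in> fst t \<Longrightarrow> dist x y \<le> 2 * rad"
  using tile_rad[of t x] tile_rad[of t y] dist_triangle2[of x y "ctr t"] by (simp add: dist_commute)

lemma tile_core: "s \<in> tiles \<Longrightarrow> x \<in> interior (fst s) \<Longrightarrow> t \<in> tiles \<Longrightarrow> dist x (ctr t) < core \<Longrightarrow> overlap s t"
proof -
  assume s: "x \<in> interior (fst s)" and t: "t \<in> tiles" and d: "dist x (ctr t) < core"
  from ctr[OF t] obtain A where A: "A \<in> \<A>" "t = shift_tile (ctr t) A" by blast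
  have "x - ctr t \<in> interior (fst A)" using core(2)[OF A(1)] d by (auto simp: dist_norm norm_minus_commute)
  then have "x \<in> interior (fst t)" by (metis A(2) mem_interior_shift_tile)
  then show ?thesis using s by (rule_tac overlapI)
qed

lemma ctr_separated: "s \<in> tiles \<Longrightarrow> t \<in> tiles \<Longrightarrow> dist (ctr s) (ctr t) < core \<Longrightarrow> overlap s t"
  using tile_core ctr_interior by blast

text \<open>Both translates contain the point \<open>ctr t + a\<close> in their interiors. Inside
  one tiling they must therefore coincide, which makes translation vectors between its tiles
  discrete.\<close>

lemma overlap_small_shift:
  assumes "t \<in> tiles" "norm (a - b) < core"
  shows "overlap (shift_tile a t) (shift_tile b t)"
proof -
  have "ctr t + a \<in> interior (fst (shift_tile a t))" using ctr_interior[OF assms(1)] by simp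
  moreover have "ctr t + a \<in> interior (fst (shift_tile b t))"
  proof -
    from ctr[OF assms(1)] obtain A where A: "A \<in> \<A>" "t = shift_tile (ctr t) A" by blast
    have "a - b \<in> interior (fst A)" using core(2)[OF A(1)] assms(2) by auto
    then have "a - b + ctr t \<in> interior (fst t)" by (subst A(2)) simp
    then show ?thesis by (simp add: algebra_simps)
  qed
  ultimately show ?thesis by (rule overlapI)
qed

text \<open>The centres of these tiles are bounded and separated by \<open>core\<close>, and they
  determine the tiles.\<close>

lemma finite_near:
  assumes "P \<subseteq> tiles" "compat P P" shows "finite (near P p r)"
proof -
  have inj: "inj_on ctr (near P p r)"
  proof (rule inj_onI)
    fix s t assume "s \<in> near P p r" "t \<in> near P p r" "ctr s = ctr t"
    then have st: "s \<in> P" "t \<in> P" using near_subset[of P p r] by blast+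
    have "dist (ctr s) (ctr t) < core" using core(1) \<open>ctr s = ctr t\<close> by simp
    then have "overlap s t" using ctr_separated[of s t] st assms(1) by blast
    then show "s = t" using compatD[OF assms(2)] st by blast
  qed
  have "bounded (ctr ` near P p r)"
  proof -
    have "dist p x \<le> r + rad" if "x \<in> ctr ` near P p r" for x
    proof -
    from that obtain t y where t: "t \<in> P" "x = ctr t" "y \<in> fst t" "y \<in> cball p r" unfolding near_def by blast
    then have "dist x y \<le> rad" using tile_rad[of t y] assms(1) by blast
    have "dist p y \<le> r" using t(4) by simp
    with \<open>dist x y \<le> rad\<close> show "dist p x \<le> r + rad"
      using dist_triangle[of p x y] by (simp add: dist_commute)
    qed
    then show ?thesis unfolding bounded_def by blast
  qed
  then have "finite (ctr ` near P p r)"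
  proof (rule finite_bounded_separated[OF _ core(1)])
    fix x y assume "x \<in> ctr ` near P p r" "y \<in> ctr ` near P p r" and d: "dist x y < core"
    then obtain s t where st: "s \<in> P" "x = ctr s" "t \<in> P" "y = ctr t"
      using near_subset[of P p r] by blast
    then have "overlap s t" using ctr_separated[of s t] d assms(1) by blast
    then show "x = y" using compatD[OF assms(2)] st by blast
  qed
  then show ?thesis using inj finite_imageD by blast
qed

lemma subst_tile_proto: "A \<in> \<A> \<Longrightarrow> subst_tile \<A> \<phi> \<omega> (shift_tile x A) = shift (\<phi> x) (\<omega> A)"
  using subst_tile_shift[OF tsub] .

lemma omega:
  assumes "A \<in> \<A>"
  shows "\<omega> A \<subseteq> tiles" "compat (\<omega> A) (\<omega> A)" "support (\<omega> A) = \<phi> ` fst A"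
proof -
  have "\<omega> A \<in> patches_over \<A>" "support (\<omega> A) = \<phi> ` fst A"
    using tsub assms by (auto simp: tile_substitution_def)
  then show "\<omega> A \<subseteq> tiles" "compat (\<omega> A) (\<omega> A)" "support (\<omega> A) = \<phi> ` fst A"
    unfolding patches_over_def patch_def tiles_def non_overlapping_iff_compat by blast+
qed

lemma subst_tile_facts:
  assumes "t \<in> tiles"
  shows "subst_tile \<A> \<phi> \<omega> t \<subseteq> tiles"
    "compat (subst_tile \<A> \<phi> \<omega> t) (subst_tile \<A> \<phi> \<omega> t)" "support (subst_tile \<A> \<phi> \<omega> t) = \<phi> ` fst t"
    "subst_tile \<A> \<phi> \<omega> (shift_tile g t) = shift (\<phi> g) (subst_tile \<A> \<phi> \<omega> t)"
proof -
  from ctr[OF assms] obtain A x where A: "A \<in> \<A>" "t = shift_tile x A" by blast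
  show "subst_tile \<A> \<phi> \<omega> t \<subseteq> tiles"
    using omega(1)[OF A(1)] by (auto simp: A subst_tile_proto shift_def)
  show "compat (subst_tile \<A> \<phi> \<omega> t) (subst_tile \<A> \<phi> \<omega> t)"
    using omega[OF A(1)] by (auto simp: A subst_tile_proto)
  show "support (subst_tile \<A> \<phi> \<omega> t) = \<phi> ` fst t"
    using omega(3)[OF A(1)] A(1)
    by (simp add: A(2) subst_tile_proto support_shift fst_shift_tile image_image phi_simps)
  show "subst_tile \<A> \<phi> \<omega> (shift_tile g t) = shift (\<phi> g) (subst_tile \<A> \<phi> \<omega> t)"
    using A(1) by (simp add: A(2) subst_tile_proto phi_simps)
qed

lemma W_single: "W {t} = subst_tile \<A> \<phi> \<omega> t"
  by (simp add: subst_def)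

lemma W_mem: "s \<in> W P \<longleftrightarrow> (\<exists>t\<in>P. s \<in> W {t})"
  unfolding subst_def by simp

lemma W_UN: "W (\<Union>i\<in>I. P i) = (\<Union>i\<in>I. W (P i))"
  unfolding subst_def by simp

lemma W_mono: "P \<subseteq> Q \<Longrightarrow> W P \<subseteq> W Q"
  unfolding subst_def by blast

lemma W_tiles: "P \<subseteq> tiles \<Longrightarrow> W P \<subseteq> tiles"
  using subst_tile_facts(1) unfolding subst_def by blast

lemma W_shift: "P \<subseteq> tiles \<Longrightarrow> W (shift g P) = shift (\<phi> g) (W P)"
proof -
  assume P: "P \<subseteq> tiles"
  have "W (shift g P) = (\<Union>t\<in>P. subst_tile \<A> \<phi> \<omega> (shift_tile g t))"
    by (simp add: subst_def shift_def)
  also have "\<dots> = (\<Union>t\<in>P. shift (\<phi> g) (subst_tile \<A> \<phi> \<omega> t))"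
    by (rule SUP_cong[OF refl], rule subst_tile_facts(4), use P in blast)
  finally show ?thesis by (simp add: subst_def shift_def image_UN)
qed

lemma W_support: "P \<subseteq> tiles \<Longrightarrow> support (W P) = \<phi> ` support P"
proof -
  assume P: "P \<subseteq> tiles"
  have "support (W P) = (\<Union>t\<in>P. support (subst_tile \<A> \<phi> \<omega> t))"
    unfolding subst_def support_def by simp
  also have "\<dots> = (\<Union>t\<in>P. \<phi> ` fst t)" using subst_tile_facts(3) P by (intro SUP_cong refl) blast
  also have "\<dots> = \<phi> ` support P" unfolding support_def by blast
  finally show ?thesis .
qed

lemma W_tile_subset: "t \<in> tiles \<Longrightarrow> s \<in> W {t} \<Longrightarrow> fst s \<subseteq> \<phi> ` fst t"
  using W_support[of "{t}"] by (auto simp: support_def)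

text \<open>A common interior point of two new tiles comes from a common interior point of their
  parents, because \<open>\<phi>\<close> is a linear bijection. The parents are then equal, and
  within the image of one tile nothing overlaps.\<close>

lemma W_compat:
  assumes "P \<subseteq> tiles" "Q \<subseteq> tiles" "compat P Q" shows "compat (W P) (W Q)"
  unfolding compat_def
proof (intro ballI impI)
  fix s s' assume s: "s \<in> W P" "s' \<in> W Q" "overlap s s'"
  then obtain t t' where t: "t \<in> P" "t' \<in> Q" "s \<in> W {t}" "s' \<in> W {t'}"
    using W_mem[of s P] W_mem[of s' Q] by blast
  have tt: "t \<in> tiles" "t' \<in> tiles" using t assms(1,2) by blast+
  have int: "interior (fst s) \<subseteq> \<phi> ` interior (fst t)" if "t \<in> tiles" "s \<in> W {t}" for s t
    using interior_mono[OF W_tile_subset[OF that]]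
    by (simp add: interior_injective_linear_image[OF linear_phi inj_phi])
  obtain q where "q \<in> interior (fst s)" "q \<in> interior (fst s')" using s(3) unfolding overlap_def by blast
  then obtain x x' where "x \<in> interior (fst t)" "x' \<in> interior (fst t')" "q = \<phi> x" "q = \<phi> x'"
    using int[OF tt(1) t(3)] int[OF tt(2) t(4)] by blast
  then have "overlap t t'" using injD[OF inj_phi] by (metis overlapI)
  then have "t = t'" using compatD[OF assms(3) t(1,2)] by blast
  then show "s = s'" using t(3,4) s(3) subst_tile_facts(2)[OF tt(1)] compatD unfolding W_single by blast
qed

lemma Wn_mono: "P \<subseteq> Q \<Longrightarrow> (W ^^ k) P \<subseteq> (W ^^ k) Q"
  by (induction k) (auto dest: W_mono)

lemma Wn_tiles: "P \<subseteq> tiles \<Longrightarrow> (W ^^ k) P \<subseteq> tiles"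
  by (induction k) (auto dest: W_tiles)

lemma Wn_shift: "P \<subseteq> tiles \<Longrightarrow> (W ^^ k) (shift g P) = shift ((\<phi> ^^ k) g) ((W ^^ k) P)"
  by (induction k) (auto simp: W_shift Wn_tiles)

lemma Wn_support: "P \<subseteq> tiles \<Longrightarrow> support ((W ^^ k) P) = (\<phi> ^^ k) ` support P"
  by (induction k) (auto simp: W_support Wn_tiles image_comp)

lemma Wn_compat: "P \<subseteq> tiles \<Longrightarrow> Q \<subseteq> tiles \<Longrightarrow> compat P Q \<Longrightarrow> compat ((W ^^ k) P) ((W ^^ k) Q)"
  by (induction k) (auto simp: W_compat Wn_tiles)

lemma Wn_UN: "(W ^^ k) P = (\<Union>t\<in>P. (W ^^ k) {t})"
proof (induction k)
  case (Suc k)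
  have "(W ^^ Suc k) P = W (\<Union>t\<in>P. (W ^^ k) {t})" unfolding funpow.simps comp_apply by (rule arg_cong[OF Suc])
  then show ?case by (simp add: W_UN)
qed simp

lemma Wn_mem: "s \<in> (W ^^ k) P \<Longrightarrow> \<exists>t\<in>P. s \<in> (W ^^ k) {t}"
  using Wn_UN by blast

lemma Wn_memI: "t \<in> P \<Longrightarrow> s \<in> (W ^^ k) {t} \<Longrightarrow> s \<in> (W ^^ k) P"
  using Wn_UN by blast

lemma Wn_tile_subset: "t \<in> tiles \<Longrightarrow> s \<in> (W ^^ k) {t} \<Longrightarrow> fst s \<subseteq> (\<phi> ^^ k) ` fst t"
  using Wn_support[of "{t}" k] by (auto simp: support_def)

lemma X_tiling: "T \<in> X \<Longrightarrow> tiling T"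
  by (simp add: tiling_space_def)

lemma X_legal: "T \<in> X \<Longrightarrow> finite P \<Longrightarrow> P \<subseteq> T \<Longrightarrow> legal \<A> \<phi> \<omega> P"
  by (simp add: tiling_space_def)

text \<open>Legality of a single tile places a translate of it inside an iterated prototile.\<close>

lemma X_tiles: assumes "T \<in> X" shows "T \<subseteq> tiles"
proof
  fix t assume "t \<in> T"
  then have "legal \<A> \<phi> \<omega> {t}" using X_legal[OF assms, of "{t}"] by simp
  then obtain n A x where "A \<in> \<A>" "shift x {t} \<subseteq> (W ^^ n) {A}" unfolding legal_def by blast
  moreover from this(1) have "(W ^^ n) {A} \<subseteq> tiles" using Wn_tiles[of "{A}" n] proto_tiles by blast
  ultimately have "shift_tile x t \<in> tiles" unfolding shift_def by blast
  then show "t \<in> tiles" by simp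
qed

lemma X_compat: "T \<in> X \<Longrightarrow> P \<subseteq> T \<Longrightarrow> Q \<subseteq> T \<Longrightarrow> compat P Q"
  using tiling_compat X_tiling by blast

lemma patch_shift: "patch P \<Longrightarrow> patch (shift g P)"
  unfolding patch_def non_overlapping_iff_compat by (simp add: finite_shift) (simp add: shift_def)

lemma X_shift: assumes "T \<in> X" shows "shift g T \<in> X"
proof -
  have "legal \<A> \<phi> \<omega> P" if P: "finite P" "P \<subseteq> shift g T" for P
  proof -
    have "shift (-g) P \<subseteq> T" using P(2) by (simp add: shift_subset_iff)
    then have "legal \<A> \<phi> \<omega> (shift (-g) P)" using X_legal[OF assms] P(1) finite_shift by blast
    then have "\<exists>n\<ge>1. \<exists>A\<in>\<A>. \<exists>x. shift (x + -g) P \<subseteq> (W ^^ n) {A}" "patch (shift (-g) P)"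
      unfolding legal_def by (auto simp del: add_uminus_conv_diff)
    moreover from this(2) have "patch P" using patch_shift[of "shift (-g) P" g] by simp
    ultimately show ?thesis unfolding legal_def by blast
  qed
  then show ?thesis using X_tiling[OF assms] tiling_shift unfolding tiling_space_def by blast
qed

lemma W_tiling: assumes "T \<subseteq> tiles" "tiling T" shows "tiling (W T)"
  using assms W_tiles[OF assms(1)] W_support[OF assms(1)] W_compat[OF assms(1,1)] tiles_is_tile surj_phi
  by (auto simp: tiling_def non_overlapping_iff_compat)

text \<open>A finite part of \<open>W T\<close> has finitely many parents in T. If these occur at
  level n, the part occurs at level n + 1.\<close>

lemma X_W: assumes "T \<in> X" shows "W T \<in> X"
proof -
  note T = X_tiles[OF assms]
  have til: "tiling (W T)" using W_tiling[OF T X_tiling[OF assms]] .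
  have "legal \<A> \<phi> \<omega> P" if P: "finite P" "P \<subseteq> W T" for P
  proof -
    have "\<forall>s\<in>P. \<exists>t\<in>T. s \<in> W {t}" using P(2) W_mem[of _ T] by blast
    then obtain f where f: "\<And>s. s \<in> P \<Longrightarrow> f s \<in> T \<and> s \<in> W {f s}" by metis
    define Q where "Q = f ` P"
    have "finite Q" using P(1) by (simp add: Q_def)
    moreover have "Q \<subseteq> T" using f unfolding Q_def by blast
    moreover have "P \<subseteq> W Q" using f W_mem[of _ Q] unfolding Q_def by blast
    ultimately have Q: "finite Q" "Q \<subseteq> T" "P \<subseteq> W Q" by blast+
    then obtain n A x where nA: "A \<in> \<A>" "shift x Q \<subseteq> (W ^^ n) {A}"
      using X_legal[OF assms Q(1,2)] unfolding legal_def by blast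
    have "shift (\<phi> x) P \<subseteq> shift (\<phi> x) (W Q)" using Q(3) by (rule shift_mono)
    also have "\<dots> = W (shift x Q)" using W_shift Q(2) T by (metis subset_trans)
    also have "\<dots> \<subseteq> (W ^^ Suc n) {A}" using nA(2) W_mono by simp
    finally have "\<exists>n\<ge>1. \<exists>A\<in>\<A>. \<exists>x. shift x P \<subseteq> (W ^^ n) {A}"
      using nA(1) by (metis le_add1 plus_1_eq_Suc)
    moreover have "patch P" using til P tiling_compat[OF til P(2) P(2)]
      unfolding patch_def non_overlapping_iff_compat tiling_def by blast
    ultimately show ?thesis unfolding legal_def by blast
  qed
  then show ?thesis using til unfolding tiling_space_def by blast
qed

lemma X_Wn: "T \<in> X \<Longrightarrow> (W ^^ k) T \<in> X"
  by (induction k) (auto simp: X_W)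

section \<open>Finiteness of local patterns, limits of tilings, and preimages under the
  substitution\<close>

subsection \<open>Compactness and surjectivity\<close>

text \<open>Distinct prototiles are not translates of each other, and a compact tile is not a
  nonzero translate of itself.\<close>

lemma ctr_unique:
  assumes "t \<in> tiles" "shift_tile x t \<in> \<A>" shows "x = - ctr t"
proof -
  let ?B = "shift_tile (- ctr t) t"
  have B: "?B \<in> \<A>" using ctr_proto assms(1) .
  have eq: "shift_tile x t = shift_tile (x + ctr t) ?B" by simp
  then have "?B = shift_tile x t"
    using proto B assms(2) unfolding prototile_set_def by blast
  then have "shift_tile (x + ctr t) ?B = shift_tile 0 ?B" using eq by (metis shift_tile_0)
  then have "x + ctr t = 0" using shift_tile_inj proto_is_tile[OF B] by blast
  then show ?thesis by (simp add: eq_neg_iff_add_eq_0)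
qed

text \<open>Demanding a prototile in its own place normalizes the translation; this turns the
  finiteness up to translation of FPC into genuine finiteness.\<close>

definition origin_patches :: "real \<Rightarrow> ('n, 'l) tile set set" where
  "origin_patches r = {near S 0 r | S. S \<in> X \<and> S \<inter> \<A> \<noteq> {}}"

lemma X_finite_near: "S \<in> X \<Longrightarrow> finite (near S p r)"
  using finite_near X_tiles X_compat by blast

lemma near_support: "S \<subseteq> tiles \<Longrightarrow> support (near S p r) \<subseteq> cball p (r + 2 * rad)"
proof
  fix x assume S: "S \<subseteq> tiles" and "x \<in> support (near S p r)"
  then obtain t y where t: "t \<in> S" "x \<in> fst t" "y \<in> fst t" "y \<in> cball p r"
    unfolding support_def near_def by blast
  then have "dist y x \<le> 2 * rad" using tile_diam[of t y x] S by blast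
  moreover have "dist p y \<le> r" using t(4) by simp
  ultimately show "x \<in> cball p (r + 2 * rad)" using dist_triangle[of p x y] by simp
qed

text \<open>FPC leaves finitely many translation classes, and each contains only finitely many
  normalized patterns.\<close>

lemma finite_origin_patches: assumes "0 \<le> r" shows "finite (origin_patches r)"
proof -
  \<comment> \<open>Twice the radius of a ball containing the supports; the 1 gives the strict
    inequality in FPC.\<close>
  define R where "R = 2 * (r + 2 * rad) + 1"
  define Y where "Y = {P. finite P \<and> (\<exists>T\<in>X. P \<subseteq> T) \<and> diameter (support P) < R}"
  have R: "R > 0" using assms rad(1) by (simp add: R_def)
  then have fin: "finite (Y // translation_equiv)" using fpc unfolding FPC_def Y_def by blast
  have LPY: "P \<in> Y \<and> P \<inter> \<A> \<noteq> {}" if P: "P \<in> origin_patches r" for P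
  proof -
    obtain S A where S: "P = near S 0 r" "S \<in> X" "A \<in> S" "A \<in> \<A>" using P unfolding origin_patches_def by blast
    have "diameter (support P) \<le> diameter (cball (0::real^'n) (r + 2 * rad))"
      unfolding S(1) by (intro diameter_subset near_support X_tiles S(2)) simp
    also have "\<dots> < R" using assms rad(1) by (simp add: R_def)
    finally have "P \<in> Y" unfolding Y_def using S(1,2) X_finite_near[OF S(2), of 0 r] near_subset[of S 0 r] by blast
    moreover have "A \<in> P"
    proof -
      have "0 \<in> fst A" using proto_0[OF S(4)] interior_subset by blast
      then show ?thesis using S(3) assms unfolding S(1) near_def by auto
    qed
    ultimately show ?thesis using S(4) by blast
  qed
  have fib: "finite {P \<in> origin_patches r. P \<in> C}" if C: "C \<in> Y // translation_equiv" for C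
  proof (cases "{P \<in> origin_patches r. P \<in> C} = {}")
    case True
    then show ?thesis by (simp only: finite.emptyI)
  next
    case False
    then obtain P0 where P0: "P0 \<in> origin_patches r" "P0 \<in> C" by blast
    obtain Q where Q: "C = translation_equiv `` {Q}" using C unfolding quotient_def by blast
    obtain a where a: "P0 = shift a Q" using P0(2) unfolding Q translation_equiv_def by blast
    have "P0 \<subseteq> tiles" using LPY[OF P0(1)] X_tiles unfolding Y_def by blast
    \<comment> \<open>A member of the class of \<open>P0\<close> is determined by the tile of
      \<open>P0\<close> that is moved onto a prototile.\<close>
    have "P \<in> (\<lambda>t. shift (- ctr t) P0) ` P0" if P: "P \<in> origin_patches r" "P \<in> C" for P
    proof -
      obtain b where b: "P = shift b Q" using P(2) unfolding Q translation_equiv_def by blast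
      have eq: "P = shift (b - a) P0" by (simp add: a b)
      obtain A where A: "A \<in> P" "A \<in> \<A>" using LPY[OF P(1)] by blast
      then obtain t where t: "t \<in> P0" "A = shift_tile (b - a) t" unfolding eq shift_def by blast
      then have "b - a = - ctr t" using ctr_unique[of t "b - a"] A(2) \<open>P0 \<subseteq> tiles\<close> by blast
      then show ?thesis using t(1) eq by auto
    qed
    then have "{P \<in> origin_patches r. P \<in> C} \<subseteq> (\<lambda>t. shift (- ctr t) P0) ` P0" by blast
    moreover have "finite P0" using LPY[OF P0(1)] by (simp add: Y_def)
    ultimately show ?thesis using finite_surj by blast
  qed
  have "origin_patches r \<subseteq> (\<Union>C\<in>Y // translation_equiv. {P \<in> origin_patches r. P \<in> C})"
  proof
    fix P assume P: "P \<in> origin_patches r"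
    have "P = shift 0 P" by simp
    then have "P \<in> translation_equiv `` {P}" unfolding translation_equiv_def by blast
    moreover have "translation_equiv `` {P} \<in> Y // translation_equiv"
      using LPY[OF P] by (intro quotientI) blast
    ultimately show "P \<in> (\<Union>C\<in>Y // translation_equiv. {P \<in> origin_patches r. P \<in> C})" using P by blast
  qed
  then show ?thesis by (rule finite_subset) (use fin fib in simp)
qed

lemma shift_ctr_meets_protos:
  assumes "S \<in> X" "t \<in> S" shows "shift (- ctr t) S \<inter> \<A> \<noteq> {}"
proof -
  have "shift_tile (- ctr t) t \<in> \<A>" using assms X_tiles ctr_proto by blast
  moreover have "shift_tile (- ctr t) t \<in> shift (- ctr t) S" using assms(2) unfolding shift_def by blast
  ultimately show ?thesis by blast
qed

lemma origin_patches_mem: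
  assumes "S \<in> X" "t \<in> S" shows "near (shift (- ctr t) S) 0 r \<in> origin_patches r"
  unfolding origin_patches_def mem_Collect_eq
  by (intro exI[of _ "shift (- ctr t) S"] conjI refl shift_ctr_meets_protos assms X_shift)

lemma ex_near_nat: "finite P \<Longrightarrow> P \<subseteq> tiles \<Longrightarrow> \<exists>N::nat. \<forall>n\<ge>N. near P 0 (real n) = P"
proof (induction P rule: finite_induct)
  case (insert t P)
  then obtain N where N: "\<forall>n\<ge>N. near P 0 (real n) = P" by blast
  define M where "M = nat \<lceil>norm (ctr t)\<rceil>"
  have "near (insert t P) 0 (real n) = insert t P" if "n \<ge> max N M" for n
  proof -
    have "norm (ctr t) \<le> real n" using that by (simp add: M_def)
    then have "ctr t \<in> cball 0 (real n)" by simp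
    then have "fst t \<inter> cball 0 (real n) \<noteq> {}" using ctr_in[of t] insert.prems by blast
    then show ?thesis using N that by (auto simp: near_def simp del: cball_def)
  qed
  then show ?case by blast
qed (simp add: near_def)

text \<open>A diagonal argument over the radii n, with finitely many patterns for each. Convergence
  means that the patterns of a fixed radius eventually equal those of the limit.\<close>

lemma X_compactness:
  fixes S :: "nat \<Rightarrow> ('n, 'l) tile set"
  assumes S: "\<And>i. S i \<in> X" "\<And>i. S i \<inter> \<A> \<noteq> {}"
  shows "\<exists>r L. strict_mono r \<and> L \<in> X \<and> (\<forall>n i. n \<le> i \<longrightarrow> near (S (r i)) 0 (real n) = near L 0 (real n))"
proof -
  define P where "P n s \<longleftrightarrow> (\<forall>i j. near (S (s i)) 0 (real n) = near (S (s j)) 0 (real n))"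
    for n :: nat and s :: "nat \<Rightarrow> nat"
  interpret subseqs P
  proof
    fix n and s :: "nat \<Rightarrow> nat"
    have "range (\<lambda>i. near (S (s i)) 0 (real n)) \<subseteq> origin_patches (real n)" using S unfolding origin_patches_def by blast
    then have "finite (range (\<lambda>i. near (S (s i)) 0 (real n)))"
      using finite_origin_patches[of "real n"] finite_subset by auto
    from finite_range_constant_subseq[OF this] obtain r :: "nat \<Rightarrow> nat" and c where
      "strict_mono r" "\<forall>i. near (S (s (r i))) 0 (real n) = c" by blast
    then show "\<exists>r'. strict_mono r' \<and> P n (s \<circ> r')" unfolding P_def by auto
  qed
  \<comment> \<open>Condition \<open>P n\<close> holds for the diagonal sequence from index n + 1
    on; the shift of the index makes \<open>n \<le> i\<close> sufficient.\<close>
  define r where "r i = diagseq (Suc i)" for i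
  have r: "strict_mono r" using subseq_diagseq unfolding r_def strict_mono_def by simp
  have diag: "P n (diagseq \<circ> (+) (Suc n))" for n by (rule diagseq_holds) (simp add: P_def)
  have same: "near (S (r i)) 0 (real n) = near (S (r j)) 0 (real n)" if le: "n \<le> i" "n \<le> j" for n i j
  proof -
    obtain i' j' where "i = n + i'" "j = n + j'" using le le_Suc_ex by blast
    then show ?thesis using diag[of n] by (simp add: P_def[of n "diagseq \<circ> (+) (Suc n)"] r_def)
  qed
  define L where "L = (\<Union>n. near (S (r n)) 0 (real n))"
  have L: "near (S (r i)) 0 (real n) = near L 0 (real n)" if "n \<le> i" for n i
  proof
    show "near (S (r i)) 0 (real n) \<subseteq> near L 0 (real n)"
      using same[of n i n] that unfolding L_def near_def by blast
    show "near L 0 (real n) \<subseteq> near (S (r i)) 0 (real n)"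
    proof
      fix t assume t: "t \<in> near L 0 (real n)"
      then obtain m where m: "t \<in> near (S (r m)) 0 (real m)" unfolding L_def near_def by blast
      then have "t \<in> near (S (r (max m i))) 0 (real m)" using same[of m m "max m i"] by simp
      then have "t \<in> near (S (r (max m i))) 0 (real n)" using t unfolding near_def by blast
      then show "t \<in> near (S (r i)) 0 (real n)" using same[of n "max m i" i] that by simp
    qed
  qed
  have Ltiles: "L \<subseteq> tiles" using S(1) X_tiles near_subset unfolding L_def by blast
  \<comment> \<open>A finite part of L lies in a single \<open>S i\<close>, from which L inherits
    non-overlapping and legality.\<close>
  have fin: "\<exists>i. P \<subseteq> S i" if P: "finite P" "P \<subseteq> L" for P
  proof -
    obtain N where N: "near P 0 (real N) = P" using ex_near_nat[OF P(1)] P(2) Ltiles by blast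
    then have "P \<subseteq> near L 0 (real N)" using P(2) unfolding near_def by blast
    then have "P \<subseteq> near (S (r N)) 0 (real N)" using L[of N N] by simp
    then show ?thesis using near_subset by blast
  qed
  have "compat L L"
    unfolding compat_def
  proof (intro ballI impI)
    fix s t assume st: "s \<in> L" "t \<in> L" "overlap s t"
    then obtain i where "{s, t} \<subseteq> S i" using fin[of "{s, t}"] by blast
    then show "s = t" using X_compat[OF S(1)] compatD st(3) by blast
  qed
  moreover have "q \<in> support L" for q
  proof -
    obtain n :: nat where n: "norm q \<le> real n" using real_arch_simple by blast
    obtain t where t: "t \<in> S (r n)" "q \<in> fst t" using tiling_cover[OF X_tiling[OF S(1)]] by blast
    have "q \<in> cball 0 (real n)" using n by simp
    then have "t \<in> L" using t unfolding L_def near_def by blast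
    then show ?thesis using t(2) unfolding support_def by blast
  qed
  ultimately have til: "tiling L"
    using Ltiles tiles_is_tile unfolding tiling_def non_overlapping_iff_compat by blast
  moreover have "legal \<A> \<phi> \<omega> P" if "finite P" "P \<subseteq> L" for P
    using fin[OF that] X_legal[OF S(1) that(1)] by blast
  ultimately have "L \<in> X" unfolding tiling_space_def by blast
  then show ?thesis using r L by blast
qed

lemma shift_tile_inj': "t \<in> tiles \<Longrightarrow> shift_tile a t = shift_tile b t \<Longrightarrow> a = b"
  using shift_tile_inj tiles_is_tile by blast

text \<open>Nearby translates of one tile overlap, hence coincide in Q, so a convergent sequence of
  translations is eventually constant. Its final value carries T into Q, and a tiling contained in
  another equals it.\<close>

lemma limit_shift:
  assumes T: "T \<in> X" and Q: "Q \<in> X" and a: "convergent a"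
    and ev: "\<And>t. t \<in> T \<Longrightarrow> \<exists>N. \<forall>n\<ge>N. shift_tile (a n) t \<in> Q"
  shows "\<exists>N b. (\<forall>n\<ge>N::nat. a n = b) \<and> shift b T = Q"
proof -
  obtain t0 where t0: "t0 \<in> T" using tiling_cover[OF X_tiling[OF T]] by blast
  then have t0t: "t0 \<in> tiles" using X_tiles T by blast
  obtain N1 where N1: "\<And>n. n \<ge> N1 \<Longrightarrow> shift_tile (a n) t0 \<in> Q" using ev[OF t0] by blast
  have "Cauchy a" using a by (simp add: Cauchy_convergent_iff)
  from CauchyD[OF this core(1)] obtain N2 where
    N2: "\<And>m n. m \<ge> N2 \<Longrightarrow> n \<ge> N2 \<Longrightarrow> norm (a m - a n) < core" by blast
  define N where "N = max N1 N2"
  have const: "a n = a N" if n: "n \<ge> N" for n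
  proof -
    have "shift_tile (a n) t0 = shift_tile (a N) t0"
      using compatD[OF X_compat[OF Q subset_refl subset_refl]]
        overlap_small_shift[OF t0t N2] N1 n by (simp add: N_def)
    then show ?thesis using shift_tile_inj' t0t by blast
  qed
  have "shift (a N) T \<subseteq> Q"
  proof
    fix s assume "s \<in> shift (a N) T"
    then obtain t where t: "t \<in> T" "s = shift_tile (a N) t" unfolding shift_def by blast
    obtain M where "\<And>n. n \<ge> M \<Longrightarrow> shift_tile (a n) t \<in> Q" using ev[OF t(1)] by blast
    then have "shift_tile (a (max M N)) t \<in> Q" by simp
    then show "s \<in> Q" using const[of "max M N"] t(2) by simp
  qed
  then have "shift (a N) T = Q"
    using tiling_eq_subset X_tiling X_shift[OF T] Q by blast
  then show ?thesis using const by blast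
qed

lemma convergent_uminus_pow: "convergent a \<Longrightarrow> convergent (\<lambda>n. - (\<phi> ^^ k) (a n))"
proof -
  assume "convergent a"
  then obtain l where l: "a \<longlonglongrightarrow> l" by (auto simp: convergent_def)
  have "bounded_linear (\<phi> ^^ k)" using linear_pow linear_conv_bounded_linear by blast
  then have "(\<lambda>n. (\<phi> ^^ k) (a n)) \<longlonglongrightarrow> (\<phi> ^^ k) l" using l bounded_linear.tendsto by blast
  then show ?thesis using tendsto_minus convergent_def by blast
qed

lemma bounded_convergent_subseq:
  fixes v :: "nat \<Rightarrow> real ^ 'n"
  assumes "\<And>n. norm (v n) \<le> B"
  shows "\<exists>s. strict_mono s \<and> convergent (v \<circ> s)"
proof -
  have "bounded (range v)" using assms by (auto intro: boundedI)
  then show ?thesis using bounded_imp_convergent_subsequence convergent_def by blast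
qed

text \<open>By legality and admissibility, every finite part of T lies in \<open>W U\<close> for
  some U in the space. A limit L of recentred tilings U exists, and \<open>limit_shift\<close>
  identifies \<open>W L\<close> as a translate of T.\<close>

lemma W_surj: assumes T: "T \<in> X" shows "\<exists>S\<in>X. W S = T"
proof -
  have "\<exists>U\<in>X. near T 0 (real n) \<subseteq> W U" for n
  proof -
    have "legal \<A> \<phi> \<omega> (near T 0 (real n))" using X_legal[OF T X_finite_near[OF T] near_subset] .
    then obtain m A x where m: "m \<ge> 1" "A \<in> \<A>" "shift x (near T 0 (real n)) \<subseteq> (W ^^ m) {A}"
      unfolding legal_def by blast
    obtain U where U: "U \<in> X" "A \<in> U" using adm m(2) unfolding admissible_def by blast
    obtain y where y: "\<phi> y = - x" using surj_phi by (metis surjD)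
    \<comment> \<open>Legality provides \<open>m \<ge> 1\<close>, so one substitution can be left to
      be applied last.\<close>
    define U' where "U' = (W ^^ (m - 1)) U"
    have U': "U' \<in> X" using X_Wn[OF U(1)] by (simp add: U'_def)
    have "(W ^^ m) {A} \<subseteq> (W ^^ m) U" using U(2) by (intro Wn_mono) simp
    also have "(W ^^ m) U = W U'" using m(1) unfolding U'_def by (cases m) auto
    finally have "shift x (near T 0 (real n)) \<subseteq> W U'" using m(3) by blast
    then have "near T 0 (real n) \<subseteq> W (shift y U')"
      using W_shift[OF X_tiles[OF U'], of y] y by (simp add: shift_subset_iff)
    then show ?thesis using X_shift[OF U'] by blast
  qed
  then obtain U where U: "\<And>n. U n \<in> X" "\<And>n. near T 0 (real n) \<subseteq> W (U n)" by metis
  have "\<exists>t\<in>U n. 0 \<in> fst t" for n using tiling_cover[OF X_tiling[OF U(1)]] by blast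
  then obtain u where u: "\<And>n. u n \<in> U n" "\<And>n. 0 \<in> fst (u n)" by metis
  define g where "g n = ctr (u n)" for n
  have g: "norm (g n) \<le> rad" for n
    using tile_rad[of "u n" 0] u X_tiles[OF U(1)] by (auto simp: g_def)
  define S where "S n = shift (- g n) (U n)" for n
  have S: "S n \<in> X" "S n \<inter> \<A> \<noteq> {}" for n
    using X_shift[OF U(1)] shift_ctr_meets_protos[OF U(1) u(1)] by (simp_all add: S_def g_def)
  obtain r L where r: "strict_mono r" "L \<in> X"
    "\<And>n i. n \<le> i \<Longrightarrow> near (S (r i)) 0 (real n) = near L 0 (real n)"
    using X_compactness[of S] S by blast
  obtain s where s: "strict_mono s" "convergent ((\<lambda>n. g (r n)) \<circ> s)"
    using bounded_convergent_subseq[of "\<lambda>n. g (r n)" rad] g by blast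
  define h where "h n = r (s n)" for n
  have hge: "n \<le> h n" "n \<le> s n" for n
    using seq_suble[OF s(1), of n] seq_suble[OF r(1), of "s n"] by (simp_all add: h_def)
  \<comment> \<open>Recentring \<open>U (h n)\<close> by \<open>- g (h n)\<close> moves its image
    under \<open>W\<close> by \<open>a n\<close>.\<close>
  define a where "a n = - \<phi> (g (h n))" for n
  have conv: "convergent a" using convergent_uminus_pow[OF s(2), of 1] by (simp add: a_def[abs_def] h_def comp_def)
  have "\<exists>N. \<forall>n\<ge>N. shift_tile (a n) t \<in> W L" if t: "t \<in> T" for t
  proof -
    have tt: "t \<in> tiles" using t X_tiles[OF T] by blast
    obtain y where y: "\<phi> y = ctr t" using surj_phi by (metis surjD)
    obtain N1 :: nat where N1: "\<And>n. n \<ge> N1 \<Longrightarrow> near {t} 0 (real n) = {t}"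
      using ex_near_nat[of "{t}"] tt by blast
    \<comment> \<open>The parent \<open>w\<close> found below contains \<open>y - g (h n)\<close>,
      which stays in a ball independent of n. On that ball \<open>S (h n)\<close> and L have the
      same tiles for large n.\<close>
    obtain N2 :: nat where N2: "norm y + rad \<le> real N2" using real_arch_simple by blast
    have "shift_tile (a n) t \<in> W L" if n: "n \<ge> max N1 N2" for n
    proof -
      have "near {t} 0 (real (h n)) = {t}" using N1[of "h n"] n hge(1)[of n] by simp
      then have "t \<in> near T 0 (real (h n))" using t unfolding near_def by blast
      then have "t \<in> W (U (h n))" using U(2) by blast
      moreover have "W (S (h n)) = shift (a n) (W (U (h n)))"
        unfolding S_def a_def using W_shift[OF X_tiles[OF U(1)]] by (simp add: phi_simps)
      ultimately have "shift_tile (a n) t \<in> W (S (h n))" unfolding shift_def by blast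
      then obtain w where w: "w \<in> S (h n)" "shift_tile (a n) t \<in> W {w}"
        using W_mem[of _ "S (h n)"] by blast
      have wt: "w \<in> tiles" using w(1) X_tiles[OF S(1)] by blast
      have "ctr t + a n \<in> fst (shift_tile (a n) t)" using ctr_in[OF tt] by simp
      moreover have "ctr t + a n = \<phi> (y - g (h n))" by (simp add: phi_simps y a_def)
      ultimately have "\<phi> (y - g (h n)) \<in> \<phi> ` fst w" using W_tile_subset[OF wt w(2)] by auto
      then have "y - g (h n) \<in> fst w" using inj_phi by (simp add: inj_image_mem_iff)
      moreover have "y - g (h n) \<in> cball 0 (real N2)"
        using norm_triangle_ineq4[of y "g (h n)"] g[of "h n"] N2 by simp
      ultimately have "w \<in> near (S (h n)) 0 (real N2)" using w(1) unfolding near_def by blast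
      then have "w \<in> near L 0 (real N2)" using r(3)[of N2 "s n"] n hge(2)[of n] by (simp add: h_def)
      then have "w \<in> L" using near_subset by blast
      then show ?thesis using w(2) W_mem[of _ L] by blast
    qed
    then show ?thesis by blast
  qed
  from limit_shift[OF T X_W[OF r(2)] conv this] obtain b where b: "shift b T = W L" by blast
  obtain c where c: "\<phi> c = - b" using surj_phi by (metis surjD)
  have "W (shift c L) = T" using W_shift[OF X_tiles[OF r(2)], of c] by (simp add: c b[symmetric])
  then show ?thesis using X_shift[OF r(2)] by blast
qed

lemma Wn_surj: "T \<in> X \<Longrightarrow> \<exists>S\<in>X. (W ^^ k) S = T"
proof (induction k arbitrary: T)
  case (Suc k)
  then obtain S where "S \<in> X" "W S = T" using W_surj by blast
  then show ?case using Suc.IH[of S] by auto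
qed auto

text \<open>A tile moved by less than \<open>core\<close> overlaps its original position, so it
  cannot move at all.\<close>

lemma small_period:
  assumes "T \<in> X" "shift v T = T" "norm v < core" shows "v = 0"
proof -
  obtain t where t: "t \<in> T" using tiling_cover[OF X_tiling[OF assms(1)]] by blast
  have tt: "t \<in> tiles" using t X_tiles assms(1) by blast
  have "shift_tile v t \<in> T" using t assms(2) unfolding shift_def by blast
  moreover have "overlap (shift_tile v t) (shift_tile 0 t)"
    using overlap_small_shift[OF tt, of v 0] assms(3) by simp
  ultimately have "shift_tile v t = shift_tile 0 t"
    using compatD[OF X_compat[OF assms(1) subset_refl subset_refl]] t by simp
  then show ?thesis using shift_tile_inj' tt by blast
qed

lemma ex_expanding_power: "\<exists>m\<ge>1. \<forall>x. 2 * norm x \<le> norm ((\<phi> ^^ m) x)"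
  using expansive_linear_inj_expanding(3)[OF expansive_phi] .

lemma inj_imp_non_periodic:
  assumes "inj_on W X" shows "non_periodic \<A> \<phi> \<omega>"
  unfolding non_periodic_def
proof (intro ballI allI impI)
  fix T v assume T: "T \<in> X" and v: "shift v T = T"
  have injn: "S = S'" if "S \<in> X" "S' \<in> X" "(W ^^ k) S = (W ^^ k) S'" for k S S'
    using that
  proof (induction k)
    case (Suc k)
    then have "(W ^^ k) S = (W ^^ k) S'" using inj_onD[OF assms] X_Wn by simp
    then show ?case using Suc by blast
  qed simp
  obtain m where m: "\<And>x. 2 * norm x \<le> norm ((\<phi> ^^ m) x)" using ex_expanding_power by blast
  have pow: "2 ^ j * norm x \<le> norm ((\<phi> ^^ (m * j)) x)" for j x
  proof (induction j)
    case (Suc j)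
    have "2 ^ Suc j * norm x \<le> 2 * norm ((\<phi> ^^ (m * j)) x)" using Suc by simp
    also have "\<dots> \<le> norm ((\<phi> ^^ m) ((\<phi> ^^ (m * j)) x))" by (rule m)
    also have "\<dots> = norm ((\<phi> ^^ (m * Suc j)) x)" by (simp add: funpow_add)
    finally show ?case .
  qed simp
  \<comment> \<open>Pulling \<open>v\<close> back through \<open>m * j\<close> levels makes it
    shorter than \<open>core\<close>.\<close>
  obtain j :: nat where j: "norm v / core < 2 ^ j" using real_arch_pow[of 2] by auto
  obtain S where S: "S \<in> X" "(W ^^ (m * j)) S = T" using Wn_surj T by blast
  obtain w where w: "(\<phi> ^^ (m * j)) w = v" using surj_pow by (metis surjD)
  have "(W ^^ (m * j)) (shift w S) = (W ^^ (m * j)) S"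
    using Wn_shift[OF X_tiles[OF S(1)]] by (simp add: w S(2) v)
  then have per: "shift w S = S" using injn X_shift S(1) by blast
  have "norm v < 2 ^ j * core" using j core(1) by (simp add: field_simps)
  then have "2 ^ j * norm w < 2 ^ j * core" using pow[of j w, unfolded w] by linarith
  then have "norm w < core" by simp
  then have "w = 0" using small_period S(1) per by blast
  then show "v = 0" using w pow_simps(3) by simp
qed

section \<open>A calculus of local agreement, and local periods at a given level\<close>

subsection \<open>Agreement after finitely many substitutions\<close>

text \<open>\<open>agree k p r S S'\<close> expresses that \<open>\<omega>\<^sup>k S\<close> and \<open>\<omega>\<^sup>k S'\<close> coincide on \<open>\<phi>\<^sup>k\<close> of the
  ball of radius \<open>r\<close> about \<open>p\<close>: the tiles coming from there never overlap properly. In this form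
  it only involves finitely many tiles of \<open>S\<close> and \<open>S'\<close>, and \<open>\<omega>\<close> preserves it.\<close>

definition agree :: "nat \<Rightarrow> real ^ 'n \<Rightarrow> real \<Rightarrow> ('n, 'l) tile set \<Rightarrow> ('n, 'l) tile set \<Rightarrow> bool" where
  "agree k p r S S' \<longleftrightarrow> compat ((W ^^ k) (near S p r)) ((W ^^ k) (near S' p r))"

lemma agree_sym: "agree k p r S S' \<longleftrightarrow> agree k p r S' S"
  unfolding agree_def by (rule compat_sym)

lemma agree_move:
  assumes "agree k q r S S'" "dist p q + r' \<le> r" shows "agree k p r' S S'"
  using assms(1) unfolding agree_def
  by (rule compat_mono) (intro Wn_mono near_move assms(2))+

lemma near_tiles: "S \<in> X \<Longrightarrow> near S p r \<subseteq> tiles"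
  using X_tiles near_subset by (metis subset_trans)

text \<open>Further substitution preserves compatibility.\<close>

lemma agree_le:
  assumes "agree k p r S S'" "k \<le> k'" "S \<in> X" "S' \<in> X" shows "agree k' p r S S'"
proof -
  obtain j where "k' = j + k" using assms(2) by (metis le_Suc_ex add.commute)
  then show ?thesis
    using Wn_compat[OF Wn_tiles[OF near_tiles[OF assms(3)]] Wn_tiles[OF near_tiles[OF assms(4)]]
        assms(1)[unfolded agree_def], of j]
    unfolding agree_def by (simp add: funpow_add)
qed

lemma agree_shift:
  assumes "S \<in> X" "S' \<in> X"
  shows "agree k p r (shift g S) (shift g S') \<longleftrightarrow> agree k (p - g) r S S'"
  unfolding agree_def near_shift' Wn_shift[OF near_tiles[OF assms(1)]] Wn_shift[OF near_tiles[OF assms(2)]]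
  by simp

text \<open>Positions at level k are named by their preimages y, so that a tile over
  \<open>(\<phi> ^^ k) y\<close> has a k-fold parent containing y. This is how the later lemmas keep
  track of radii.\<close>

lemma Wn_cover:
  assumes "T \<in> X"
  shows "\<exists>t\<in>T. \<exists>s. s \<in> (W ^^ k) {t} \<and> (\<phi> ^^ k) y \<in> fst s \<and> y \<in> fst t \<and> is_tile s"
proof -
  obtain s where s: "s \<in> (W ^^ k) T" "(\<phi> ^^ k) y \<in> fst s"
    using tiling_cover[OF X_tiling[OF X_Wn[OF assms]]] by blast
  obtain t where t: "t \<in> T" "s \<in> (W ^^ k) {t}" using Wn_mem[OF s(1)] by blast
  have tt: "t \<in> tiles" using t(1) X_tiles[OF assms] by blast
  have "(\<phi> ^^ k) y \<in> (\<phi> ^^ k) ` fst t" using Wn_tile_subset[OF tt t(2)] s(2) by blast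
  then have "y \<in> fst t" using inj_pow by (simp add: inj_image_mem_iff)
  moreover have "is_tile s" using X_tiling[OF X_Wn[OF assms]] s(1) unfolding tiling_def by blast
  ultimately show ?thesis using s t by blast
qed

lemma Wn_point:
  assumes "P \<subseteq> tiles" "s \<in> (W ^^ k) P" "(\<phi> ^^ k) y \<in> interior (fst s)"
  shows "\<exists>t\<in>P. s \<in> (W ^^ k) {t} \<and> y \<in> fst t"
proof -
  obtain t where t: "t \<in> P" "s \<in> (W ^^ k) {t}" using Wn_mem[OF assms(2)] by blast
  have "(\<phi> ^^ k) y \<in> (\<phi> ^^ k) ` fst t"
    using Wn_tile_subset[OF _ t(2)] assms t(1) interior_subset by blast
  then have "y \<in> fst t" using inj_pow by (simp add: inj_image_mem_iff)
  then show ?thesis using t by blast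
qed

lemma overlap_preimage:
  assumes "overlap s s'"
  shows "\<exists>y. (\<phi> ^^ k) y \<in> interior (fst s) \<and> (\<phi> ^^ k) y \<in> interior (fst s')"
proof -
  obtain q where "q \<in> interior (fst s)" "q \<in> interior (fst s')" using assms unfolding overlap_def by blast
  moreover obtain y where "q = (\<phi> ^^ k) y" using surj_pow[of k] by (meson surjD)
  ultimately show ?thesis by blast
qed

lemma near_dist:
  assumes "S \<in> X" "t \<in> near S p r" "y \<in> fst t" shows "dist p y \<le> r + 2 * rad"
proof -
  have "y \<in> support (near S p r)" using assms(2,3) unfolding support_def by blast
  then have "y \<in> cball p (r + 2 * rad)" using near_support[OF X_tiles[OF assms(1)]] by blast
  then show ?thesis by simp
qed

lemma near_memI: "t \<in> S \<Longrightarrow> y \<in> fst t \<Longrightarrow> dist p y \<le> r \<Longrightarrow> t \<in> near S p r"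
  unfolding near_def by (simp add: disjoint_iff) blast

text \<open>At a common interior point of \<open>s\<close> and \<open>s''\<close> the middle tiling
  supplies a tile equal to both. That point can lie outside the ball by up to the diameter of a
  tile, hence the loss of \<open>2 * rad\<close>.\<close>

lemma agree_trans:
  assumes X: "S \<in> X" "S' \<in> X" "S'' \<in> X" and agree: "agree k p r S S'" "agree k p r S' S''"
  shows "agree k p (r - 2 * rad) S S''"
  unfolding agree_def compat_def
proof (intro ballI impI)
  fix s s'' assume s: "s \<in> (W ^^ k) (near S p (r - 2 * rad))"
    and s'': "s'' \<in> (W ^^ k) (near S'' p (r - 2 * rad))" and o: "overlap s s''"
  obtain y where y: "(\<phi> ^^ k) y \<in> interior (fst s)" "(\<phi> ^^ k) y \<in> interior (fst s'')"
    using overlap_preimage[OF o] by blast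
  obtain t where t: "t \<in> near S p (r - 2 * rad)" "y \<in> fst t"
    using Wn_point[OF near_tiles[OF X(1)] s y(1)] by blast
  have dy: "dist p y \<le> r" using near_dist[OF X(1) t] by simp
  obtain t' s' where t': "t' \<in> S'" "s' \<in> (W ^^ k) {t'}" "(\<phi> ^^ k) y \<in> fst s'" "y \<in> fst t'" "is_tile s'"
    using Wn_cover[OF X(2)] by blast
  have s': "s' \<in> (W ^^ k) (near S' p r)"
    using Wn_memI[OF near_memI[OF t'(1,4) dy] t'(2)] .
  have le: "r - 2 * rad \<le> r" using rad(1) by simp
  have mem: "s \<in> (W ^^ k) (near S p r)" "s'' \<in> (W ^^ k) (near S'' p r)"
    using s s'' Wn_mono[OF near_mono[OF le, of S p], of k] Wn_mono[OF near_mono[OF le, of S'' p], of k]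
    by blast+
  have "overlap s s'" using overlap_boundary[OF t'(5,3) y(1)] overlap_sym[of s s'] by simp
  then have "s = s'" using compatD[OF agree(1)[unfolded agree_def] mem(1) s'] by blast
  moreover have "s' = s''"
    using compatD[OF agree(2)[unfolded agree_def] s' mem(2)] overlap_boundary[OF t'(5,3) y(2)] by blast
  ultimately show "s = s''" by simp
qed

text \<open>An overlap takes place over a single point y and only concerns parents containing y,
  which radius 0 captures.\<close>

lemma agree_local:
  assumes X: "S \<in> X" "S' \<in> X" and loc: "\<And>y. dist p y \<le> r + 2 * rad \<Longrightarrow> agree k y 0 S S'"
  shows "agree k p r S S'"
  unfolding agree_def compat_def
proof (intro ballI impI)
  fix s s' assume s: "s \<in> (W ^^ k) (near S p r)" and s': "s' \<in> (W ^^ k) (near S' p r)" and o: "overlap s s'"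
  obtain y where y: "(\<phi> ^^ k) y \<in> interior (fst s)" "(\<phi> ^^ k) y \<in> interior (fst s')"
    using overlap_preimage[OF o] by blast
  obtain t where t: "t \<in> near S p r" "s \<in> (W ^^ k) {t}" "y \<in> fst t"
    using Wn_point[OF near_tiles[OF X(1)] s y(1)] by blast
  obtain t' where t': "t' \<in> near S' p r" "s' \<in> (W ^^ k) {t'}" "y \<in> fst t'"
    using Wn_point[OF near_tiles[OF X(2)] s' y(2)] by blast
  have "agree k y 0 S S'" using loc near_dist[OF X(1) t(1,3)] by blast
  moreover have "s \<in> (W ^^ k) (near S y 0)" "s' \<in> (W ^^ k) (near S' y 0)"
    using Wn_memI[OF near_memI[of t S y y 0] t(2)] Wn_memI[OF near_memI[of t' S' y y 0] t'(2)]
      t(1,3) t'(1,3) near_subset[of S p r] near_subset[of S' p r] by auto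
  ultimately show "s = s'" using compatD o unfolding agree_def by blast
qed

text \<open>Away from the rim of the ball, absence of conflicts means actual membership, because
  \<open>(W ^^ k) S'\<close> covers the space.\<close>

lemma agree_transfer:
  assumes X: "S \<in> X" "S' \<in> X" and agree: "agree k p r S S'"
    and s: "s \<in> (W ^^ k) (near S p (r - 2 * rad))"
  shows "s \<in> (W ^^ k) S'"
proof -
  have "s \<in> tiles" using s Wn_tiles[OF near_tiles[OF X(1)]] by blast
  then obtain y where y: "(\<phi> ^^ k) y \<in> interior (fst s)"
    using overlap_preimage[OF overlap_refl[OF tiles_is_tile]] by blast
  obtain t where t: "t \<in> near S p (r - 2 * rad)" "y \<in> fst t"
    using Wn_point[OF near_tiles[OF X(1)] s y(1)] by blast
  have dy: "dist p y \<le> r" using near_dist[OF X(1) t] by simp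
  obtain t' s' where t': "t' \<in> S'" "s' \<in> (W ^^ k) {t'}" "(\<phi> ^^ k) y \<in> fst s'" "y \<in> fst t'" "is_tile s'"
    using Wn_cover[OF X(2)] by blast
  have s': "s' \<in> (W ^^ k) (near S' p r)"
    using Wn_memI[OF near_memI[OF t'(1,4) dy] t'(2)] .
  have le: "r - 2 * rad \<le> r" using rad(1) by simp
  have "overlap s s'" using overlap_boundary[OF t'(5,3) y(1)] overlap_sym[of s s'] by simp
  then have "s = s'"
    using compatD[OF agree[unfolded agree_def] _ s'] s Wn_mono[OF near_mono[OF le, of S p], of k] by blast
  then show ?thesis using Wn_memI[OF t'(1,2)] by simp
qed

text \<open>Trades m levels for a ball of twice the radius: since \<open>\<phi> ^^ m\<close> at
  least doubles distances, tiles of \<open>(W ^^ m) S\<close> near the doubled ball have parents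
  near the original one.\<close>

lemma agree_scale:
  assumes X: "S \<in> X" "S' \<in> X" and m: "\<And>x. 2 * norm x \<le> norm ((\<phi> ^^ m) x)"
    and agree: "agree (k + m) p r S S'"
  shows "agree k ((\<phi> ^^ m) p) (2 * r) ((W ^^ m) S) ((W ^^ m) S')"
proof -
  have sub: "near ((W ^^ m) S) ((\<phi> ^^ m) p) (2 * r) \<subseteq> (W ^^ m) (near S p r)" if S: "S \<in> X" for S
  proof
    fix s assume "s \<in> near ((W ^^ m) S) ((\<phi> ^^ m) p) (2 * r)"
    then obtain q where q: "s \<in> (W ^^ m) S" "q \<in> fst s" "q \<in> cball ((\<phi> ^^ m) p) (2 * r)"
      unfolding near_def by blast
    obtain t where t: "t \<in> S" "s \<in> (W ^^ m) {t}" using Wn_mem[OF q(1)] by blast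
    have "t \<in> tiles" using t(1) X_tiles[OF S] by blast
    then obtain y where y: "y \<in> fst t" "q = (\<phi> ^^ m) y" using Wn_tile_subset t(2) q(2) by blast
    have "2 * norm (p - y) \<le> 2 * r" using m[of "p - y"] q(3) by (simp add: y(2) dist_norm pow_simps)
    then have "dist p y \<le> r" by (simp add: dist_norm)
    then show "s \<in> (W ^^ m) (near S p r)" using Wn_memI near_memI t y(1) by blast
  qed
  have "(W ^^ k) (near ((W ^^ m) S) ((\<phi> ^^ m) p) (2 * r)) \<subseteq> (W ^^ (k + m)) (near S p r)" if "S \<in> X" for S
    using Wn_mono[OF sub[OF that], of k] by (simp add: funpow_add)
  then show ?thesis using compat_mono agree X unfolding agree_def by blast
qed

text \<open>The tiles of \<open>shift v S\<close> near p come from those of S near p - v, so a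
  collar of width 1 determines everything.\<close>

lemma agree_cong:
  assumes "near S p (r + 1) = near S2 p (r + 1)" "norm v \<le> 1" and agree: "agree k p r S (shift v S)"
  shows "agree k p r S2 (shift v S2)"
proof -
  have "near S p r = near S2 p r" using assms(1) by (rule near_eqD) simp
  moreover have "near S (p - v) r = near S2 (p - v) r"
    using assms(1) by (rule near_eqD) (use assms(2) in \<open>simp add: dist_norm\<close>)
  ultimately show ?thesis using agree unfolding agree_def near_shift' by simp
qed

text \<open>Failure of repulsion with radius \<open>\<rho>\<close> at level k.\<close>

definition local_period :: "nat \<Rightarrow> nat \<Rightarrow> bool" where
  "local_period \<rho> k \<longleftrightarrow> (\<exists>S\<in>X. \<exists>p v. v \<noteq> 0 \<and> norm v \<le> 1 \<and> agree k p (real \<rho>) S (shift v S))"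

lemma local_period_antimono: assumes "local_period \<rho> k" "\<rho>' \<le> \<rho>" shows "local_period \<rho>' k"
proof -
  have "agree k p (real \<rho>) S S' \<Longrightarrow> agree k p (real \<rho>') S S'" for p S S'
    by (erule agree_move) (use assms(2) in simp)
  then show ?thesis using assms(1) unfolding local_period_def by blast
qed

lemma agree_recenter:
  assumes "S \<in> X"
  shows "agree k p r (shift g S) (shift v (shift g S)) \<longleftrightarrow> agree k (p - g) r S (shift v S)"
proof -
  have "shift v (shift g S) = shift g (shift v S)" by (simp add: add.commute)
  then show ?thesis using agree_shift[OF assms X_shift[OF assms]] by simp
qed

lemma local_period_origin: "local_period \<rho> k \<Longrightarrow> \<exists>S\<in>X. \<exists>v. v \<noteq> 0 \<and> norm v \<le> 1 \<and> agree k 0 (real \<rho>) S (shift v S)"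
proof -
  assume "local_period \<rho> k"
  then obtain S p v where S: "S \<in> X" "v \<noteq> 0" "norm v \<le> 1" "agree k p (real \<rho>) S (shift v S)"
    unfolding local_period_def by blast
  have "agree k 0 (real \<rho>) (shift (- p) S) (shift v (shift (- p) S))"
    unfolding agree_recenter[OF S(1)] using S(4) by simp
  then show ?thesis using S X_shift by blast
qed

text \<open>Otherwise a limit L of witnesses has approximate periods of \<open>(W ^^ k) L\<close> on
  growing balls. By \<open>limit_shift\<close> these vectors are eventually constant, so they become
  a true period; being nonzero, they contradict non-periodicity, even though nothing bounds them
  away from 0 beforehand.\<close>

lemma fixed_level_no_local_period:
  assumes np: "non_periodic \<A> \<phi> \<omega>" shows "\<exists>\<rho>. \<not> local_period \<rho> k"
proof (rule ccontr)
  assume "\<nexists>\<rho>. \<not> local_period \<rho> k"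
  then have local_period: "local_period \<rho> k" for \<rho> by blast
  have "\<exists>S v. S \<in> X \<and> S \<inter> \<A> \<noteq> {} \<and> v \<noteq> 0 \<and> norm v \<le> 1 \<and> agree k 0 (real i) S (shift v S)" for i
  proof -
    \<comment> \<open>Room for recentring at a tile that covers the origin.\<close>
    obtain C :: nat where C: "rad \<le> real C" using real_arch_simple by blast
    obtain S v where S: "S \<in> X" "v \<noteq> 0" "norm v \<le> 1" "agree k 0 (real (i + C)) S (shift v S)"
      using local_period_origin[OF local_period] by blast
    obtain t where t: "t \<in> S" "0 \<in> fst t" using tiling_cover[OF X_tiling[OF S(1)]] by blast
    have "norm (ctr t) \<le> rad" using tile_rad[of t 0] t X_tiles[OF S(1)] by auto
    then have "agree k (ctr t) (real i) S (shift v S)" using agree_move[OF S(4)] C by simp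
    then have "agree k 0 (real i) (shift (- ctr t) S) (shift v (shift (- ctr t) S))"
      unfolding agree_recenter[OF S(1)] by simp
    then show ?thesis using shift_ctr_meets_protos[OF S(1) t(1)] X_shift[OF S(1)] S(2,3) by blast
  qed
  then obtain S v where S: "\<And>i. S i \<in> X" "\<And>i. S i \<inter> \<A> \<noteq> {}" "\<And>i. v i \<noteq> 0" "\<And>i. norm (v i) \<le> 1"
    "\<And>i. agree k 0 (real i) (S i) (shift (v i) (S i))" by metis
  obtain r L where r: "strict_mono r" "L \<in> X"
    "\<And>n i. n \<le> i \<Longrightarrow> near (S (r i)) 0 (real n) = near L 0 (real n)"
    using X_compactness[of S] S(1,2) by blast
  obtain s where s: "strict_mono s" "convergent ((\<lambda>n. v (r n)) \<circ> s)"
    using bounded_convergent_subseq[of "\<lambda>n. v (r n)" 1] S(4) by blast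
  define w where "w n = v (r (s n))" for n
  define a where "a n = - (\<phi> ^^ k) (w n)" for n
  have conv: "convergent a" using convergent_uminus_pow[OF s(2), of k] by (simp add: a_def[abs_def] w_def comp_def)
  \<comment> \<open>The extra unit in \<open>Suc N\<close> is the collar of
    \<open>agree_cong\<close>.\<close>
  have agree: "agree k 0 (real N) L (shift (w n) L)" if n: "Suc N \<le> n" for N n
  proof -
    have sn: "n \<le> s n" using seq_suble[OF s(1)] .
    have rn: "s n \<le> r (s n)" using seq_suble[OF r(1)] .
    have "agree k 0 (real N) (S (r (s n))) (shift (w n) (S (r (s n))))"
      unfolding w_def by (rule agree_move[OF S(5)]) (use n sn rn in simp)
    moreover have "near (S (r (s n))) 0 (real N + 1) = near L 0 (real N + 1)"
      using r(3)[of "Suc N" "s n"] n sn by (simp add: add.commute)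
    ultimately show ?thesis using agree_cong S(4) unfolding w_def by blast
  qed
  have ev: "\<exists>N. \<forall>n\<ge>N. shift_tile (a n) t \<in> (W ^^ k) L" if t: "t \<in> (W ^^ k) L" for t
  proof -
    obtain t0 where t0: "t0 \<in> L" "t \<in> (W ^^ k) {t0}" using Wn_mem[OF t] by blast
    obtain M :: nat where M: "norm (ctr t0) + 2 * rad \<le> real M" using real_arch_simple by blast
    have "ctr t0 \<in> fst t0" using ctr_in t0(1) X_tiles[OF r(2)] by blast
    then have "t0 \<in> near L 0 (real M - 2 * rad)" using near_memI[OF t0(1)] M by simp
    then have tn: "t \<in> (W ^^ k) (near L 0 (real M - 2 * rad))" using Wn_memI t0(2) by blast
    have "shift_tile (a n) t \<in> (W ^^ k) L" if n: "n \<ge> Suc M" for n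
    proof -
      have "t \<in> (W ^^ k) (shift (w n) L)"
        using agree_transfer[OF r(2) X_shift[OF r(2)] agree[OF n] tn] .
      then show ?thesis unfolding Wn_shift[OF X_tiles[OF r(2)]] by (simp add: mem_shift a_def)
    qed
    then show ?thesis by blast
  qed
  obtain N b where b: "\<And>n. n \<ge> N \<Longrightarrow> a n = b" "shift b ((W ^^ k) L) = (W ^^ k) L"
    using limit_shift[OF X_Wn[OF r(2)] X_Wn[OF r(2)] conv ev] by blast
  have "b = 0" using np b(2) X_Wn[OF r(2)] unfolding non_periodic_def by blast
  then have "(\<phi> ^^ k) (w N) = 0" using b(1)[of N] by (simp add: a_def)
  then show False using pow_eq_0 S(3) unfolding w_def by blast
qed

lemma low_levels_no_local_period:
  assumes np: "non_periodic \<A> \<phi> \<omega>" shows "\<exists>\<rho>. \<forall>k\<le>K. \<not> local_period \<rho> k"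
proof (induction K)
  case 0
  then show ?case using fixed_level_no_local_period[OF np, of 0] by auto
next
  case (Suc K)
  then obtain a b where "\<forall>k\<le>K. \<not> local_period a k" "\<not> local_period b (Suc K)" using fixed_level_no_local_period[OF np] by blast
  then have "\<forall>k\<le>Suc K. \<not> local_period (max a b) k"
    using local_period_antimono by (metis le_SucE max.cobounded1 max.cobounded2)
  then show ?case by blast
qed

section \<open>Minimal witnesses against repulsion, and stabilization of offsets\<close>

subsection \<open>Repulsion and recognizability\<close>

text \<open>Assembles a ball from neighbourhoods of tile centres by means of
  \<open>agree_local\<close>. The displacement \<open>u\<close> is needed because comparing
  translates by two vectors yields agreement displaced by one of them.\<close>

lemma agree_full_ball:
  assumes S: "S \<in> X" and agree: "\<And>t. t \<in> S \<Longrightarrow> norm (ctr t) \<le> R \<Longrightarrow> agree k (ctr t - u) rad S (shift v S)"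
    and r: "r + 3 * rad + norm u \<le> R"
  shows "agree k 0 r S (shift v S)"
proof (rule agree_local[OF S X_shift[OF S]])
  fix y :: "real ^ 'n" assume y: "dist 0 y \<le> r + 2 * rad"
  obtain t where t: "t \<in> S" "y + u \<in> fst t" using tiling_cover[OF X_tiling[OF S]] by blast
  have d: "dist (ctr t) (y + u) \<le> rad" using tile_rad[of t "y + u"] t X_tiles[OF S] by blast
  have "norm (ctr t) \<le> norm (y + u) + rad"
    using norm_triangle_sub[of "ctr t" "y + u"] d by (simp add: dist_norm)
  also have "\<dots> \<le> R" using norm_triangle_ineq[of y u] y r by simp
  finally have "agree k (ctr t - u) rad S (shift v S)" using agree t(1) by blast
  then show "agree k y 0 S (shift v S)"
    by (rule agree_move) (use d in \<open>simp add: dist_norm norm_minus_commute algebra_simps\<close>)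
qed

lemma repulsion:
  assumes np: "non_periodic \<A> \<phi> \<omega>" shows "\<exists>\<rho>. \<forall>k. \<not> local_period \<rho> k"
proof (rule ccontr)
  assume "\<nexists>\<rho>. \<forall>k. \<not> local_period \<rho> k"
  then have ex: "\<exists>k. local_period \<rho> k" for \<rho> by blast
  define K where "K \<rho> = (LEAST k. local_period \<rho> k)" for \<rho>
  have K: "local_period \<rho> (K \<rho>)" for \<rho> unfolding K_def using ex by (rule LeastI_ex)
  have Kle: "K \<rho> \<le> k" if "local_period \<rho> k" for \<rho> k unfolding K_def using that by (rule Least_le)
  have Klarge: "\<exists>\<rho>0. \<forall>\<rho>\<ge>\<rho>0. k < K \<rho>" for k
  proof -
    obtain \<rho>0 where "\<forall>j\<le>k. \<not> local_period \<rho>0 j" using low_levels_no_local_period[OF np] by blast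
    then have "\<forall>\<rho>\<ge>\<rho>0. k < K \<rho>" using local_period_antimono K by (meson not_le)
    then show ?thesis by blast
  qed
  have "\<exists>S v. S \<in> X \<and> v \<noteq> 0 \<and> norm v \<le> 1 \<and> agree (K \<rho>) 0 (real \<rho>) S (shift v S)" for \<rho>
    using local_period_origin[OF K] by blast
  then obtain S v where S: "\<And>\<rho>. S \<rho> \<in> X" "\<And>\<rho>. v \<rho> \<noteq> 0" "\<And>\<rho>. norm (v \<rho>) \<le> 1"
    "\<And>\<rho>. agree (K \<rho>) 0 (real \<rho>) (S \<rho>) (shift (v \<rho>) (S \<rho>))" by metis
  \<comment> \<open>Combining the agreements for two vectors costs \<open>2 * rad\<close> and must
    leave \<open>rad\<close> for \<open>agree_full_ball\<close>; the 1 is the collar of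
    \<open>agree_cong\<close>.\<close>
  define R where "R = 3 * rad + 1"
  have R: "R \<ge> 0" using rad(1) by (simp add: R_def)
  \<comment> \<open>Only tiles so deep inside the ball that the witnessed agreement covers their
    surroundings. Each \<open>Q \<rho>\<close> is a subset of one finite set, so the pigeonhole
    principle applies.\<close>
  define Q where "Q \<rho> = {near (shift (- ctr t) (S \<rho>)) 0 R | t. t \<in> S \<rho> \<and> norm (ctr t) \<le> real \<rho> - R}" for \<rho>
  have "Q \<rho> \<subseteq> origin_patches R" for \<rho> unfolding Q_def using origin_patches_mem[OF S(1)] by blast
  then have "range Q \<subseteq> Pow (origin_patches R)" by blast
  then have "finite (range Q)" using finite_origin_patches[OF R] finite_subset by blast
  then obtain r Q0 where r: "strict_mono (r :: nat \<Rightarrow> nat)" "\<And>n. Q (r n) = Q0"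
    using finite_range_constant_subseq[of Q] by blast
  obtain s where s: "strict_mono s" "convergent ((\<lambda>n. v (r n)) \<circ> s)"
    using bounded_convergent_subseq[of "\<lambda>n. v (r n)" 1] S(3) by blast
  define h where "h n = r (s n)" for n
  have hge: "n \<le> h n" for n
    using seq_suble[OF s(1), of n] seq_suble[OF r(1), of "s n"] by (simp add: h_def)
  obtain m where m: "m \<ge> 1" "\<And>x. 2 * norm x \<le> norm ((\<phi> ^^ m) x)" using ex_expanding_power by blast
  obtain B where B: "B > 0" "\<And>x. norm ((\<phi> ^^ m) x) \<le> B * norm x"
    using linear_bounded_pos[OF linear_pow] by blast
  have "Cauchy (\<lambda>n. v (h n))" using s(2) by (simp add: Cauchy_convergent_iff h_def comp_def)
  \<comment> \<open>Closeness \<open>1 / B\<close> guarantees that the difference still has norm at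
    most 1 after applying \<open>\<phi> ^^ m\<close>.\<close>
  from CauchyD[OF this, of "1 / B"] B(1) obtain n1 where
    n1: "\<And>i j. i \<ge> n1 \<Longrightarrow> j \<ge> n1 \<Longrightarrow> norm (v (h i) - v (h j)) < 1 / B" by auto
  \<comment> \<open>The total loss in \<open>agree_full_ball\<close>: \<open>R + 3 * rad\<close>,
    plus 1 for the norm of \<open>u\<close>.\<close>
  obtain C :: nat where C: "6 * rad + 2 \<le> real C" using real_arch_simple by blast
  define \<rho>1 where "\<rho>1 = h n1"
  obtain b1 where b1: "\<And>\<rho>. \<rho> \<ge> b1 \<Longrightarrow> K \<rho>1 < K \<rho>" using Klarge by blast
  obtain b2 where b2: "\<And>\<rho>. \<rho> \<ge> b2 \<Longrightarrow> m < K \<rho>" using Klarge by blast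
  \<comment> \<open>The summand \<open>2 * C\<close> keeps \<open>\<rho>2 - C\<close> at least
    \<open>b1\<close>, and lets the doubled ball of radius \<open>\<rho>2 - C\<close> contain the
    ball of radius \<open>\<rho>2\<close> again.\<close>
  define n2 where "n2 = n1 + b1 + b2 + 2 * C"
  define \<rho>2 where "\<rho>2 = h n2"
  have \<rho>2: "\<rho>2 \<ge> n1 + b1 + b2 + 2 * C" using hge[of n2] by (simp add: \<rho>2_def n2_def)
  have K12: "K \<rho>1 < K (\<rho>2 - C)" "K \<rho>1 < K \<rho>2" "m < K \<rho>2" using b1 b2 \<rho>2 by auto
  have QQ: "Q \<rho>1 = Q \<rho>2" by (simp add: \<rho>1_def \<rho>2_def h_def r(2))
  let ?T = "S \<rho>2"
  have T: "?T \<in> X" by (rule S(1))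
  \<comment> \<open>The local patterns of \<open>S \<rho>2\<close> in its ball all occur in the ball of \<open>S \<rho>1\<close>, so \<open>v \<rho>1\<close> is
    a local period of \<open>S \<rho>2\<close> as well, even at the smaller level \<open>K \<rho>1\<close>.\<close>
  have per1: "agree (K \<rho>1) (ctr t) (3 * rad) ?T (shift (v \<rho>1) ?T)"
    if t: "t \<in> ?T" "norm (ctr t) \<le> real \<rho>2 - R" for t
  proof -
    have "near (shift (- ctr t) ?T) 0 R \<in> Q \<rho>1" unfolding QQ unfolding Q_def using t by blast
    then obtain t' where t': "t' \<in> S \<rho>1" "norm (ctr t') \<le> real \<rho>1 - R"
      "near (shift (- ctr t) ?T) 0 R = near (shift (- ctr t') (S \<rho>1)) 0 R" unfolding Q_def by blast
    have "agree (K \<rho>1) (ctr t') (3 * rad) (S \<rho>1) (shift (v \<rho>1) (S \<rho>1))"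
      by (rule agree_move[OF S(4)]) (use t'(2) in \<open>simp add: R_def\<close>)
    then have "agree (K \<rho>1) 0 (3 * rad) (shift (- ctr t') (S \<rho>1)) (shift (v \<rho>1) (shift (- ctr t') (S \<rho>1)))"
      unfolding agree_recenter[OF S(1)] by simp
    then have "agree (K \<rho>1) 0 (3 * rad) (shift (- ctr t) ?T) (shift (v \<rho>1) (shift (- ctr t) ?T))"
      by (rule agree_cong[OF _ S(3), rotated]) (use t'(3) in \<open>simp add: R_def\<close>)
    then show ?thesis unfolding agree_recenter[OF T] by simp
  qed
  have per2: "agree (K \<rho>2) (ctr t) (3 * rad) ?T (shift (v \<rho>2) ?T)"
    if t: "norm (ctr t) \<le> real \<rho>2 - R" for t
    by (rule agree_move[OF S(4)]) (use t in \<open>simp add: R_def\<close>)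
  have rC: "real (\<rho>2 - C) = real \<rho>2 - real C" using \<rho>2 by simp
  show False
  proof (cases "v \<rho>1 = v \<rho>2")
    case True
    have "agree (K \<rho>1) 0 (real (\<rho>2 - C)) ?T (shift (v \<rho>1) ?T)"
    proof (rule agree_full_ball[OF T, where u = 0 and R = "real \<rho>2 - R"])
      show "agree (K \<rho>1) (ctr t - 0) rad ?T (shift (v \<rho>1) ?T)" if "t \<in> ?T" "norm (ctr t) \<le> real \<rho>2 - R" for t
        by (rule agree_move[OF per1[OF that]]) (use rad(1) in simp)
    qed (use C in \<open>simp add: rC R_def\<close>)
    then have "local_period (\<rho>2 - C) (K \<rho>1)" unfolding local_period_def using T S(2,3) by blast
    then show False using Kle K12(1) by (meson not_le)
  next
    case False
    define w where "w = v \<rho>2 - v \<rho>1"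
    have agree: "agree (K \<rho>2) 0 (real (\<rho>2 - C)) ?T (shift w ?T)"
    proof (rule agree_full_ball[OF T, where u = "v \<rho>1" and R = "real \<rho>2 - R"])
      fix t assume t: "t \<in> ?T" "norm (ctr t) \<le> real \<rho>2 - R"
      have "agree (K \<rho>2) (ctr t) (3 * rad) ?T (shift (v \<rho>1) ?T)"
        by (rule agree_le[OF per1[OF t] _ T X_shift[OF T]]) (use K12 in simp)
      then have "agree (K \<rho>2) (ctr t) (3 * rad - 2 * rad) (shift (v \<rho>1) ?T) (shift (v \<rho>2) ?T)"
        using agree_trans[OF X_shift[OF T] T X_shift[OF T] _ per2[OF t(2)]] agree_sym by blast
      then have "agree (K \<rho>2) (ctr t) rad (shift (v \<rho>1) ?T) (shift (v \<rho>1) (shift w ?T))"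
        by (simp add: w_def)
      then show "agree (K \<rho>2) (ctr t - v \<rho>1) rad ?T (shift w ?T)"
        unfolding agree_shift[OF T X_shift[OF T]] .
    qed (use C S(3)[of \<rho>1] in \<open>simp add: rC R_def\<close>)
    have km: "K \<rho>2 = (K \<rho>2 - m) + m" using K12(3) by simp
    have "agree (K \<rho>2 - m) ((\<phi> ^^ m) 0) (2 * real (\<rho>2 - C)) ((W ^^ m) ?T) ((W ^^ m) (shift w ?T))"
      by (rule agree_scale[OF T X_shift[OF T] m(2)]) (use agree km in simp)
    then have "agree (K \<rho>2 - m) 0 (2 * real (\<rho>2 - C)) ((W ^^ m) ?T) (shift ((\<phi> ^^ m) w) ((W ^^ m) ?T))"
      by (simp add: pow_simps Wn_shift[OF X_tiles[OF T]])
    then have "agree (K \<rho>2 - m) 0 (real \<rho>2) ((W ^^ m) ?T) (shift ((\<phi> ^^ m) w) ((W ^^ m) ?T))"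
      by (rule agree_move) (use \<rho>2 in \<open>simp add: rC\<close>)
    moreover have "(\<phi> ^^ m) w \<noteq> 0" using False pow_eq_0 by (simp add: w_def)
    moreover have "norm ((\<phi> ^^ m) w) \<le> 1"
    proof -
      have "norm w < 1 / B" using n1[of n2 n1] by (simp add: w_def \<rho>1_def \<rho>2_def n2_def)
      then have "B * norm w \<le> 1" using B(1) by (simp add: field_simps)
      then show ?thesis using B(2)[of w] by simp
    qed
    ultimately have "local_period \<rho>2 (K \<rho>2 - m)" unfolding local_period_def using X_Wn[OF T] by blast
    then have "K \<rho>2 \<le> K \<rho>2 - m" by (rule Kle)
    then show False using m(1) K12(3) by simp
  qed
qed

text \<open>The relative positions at which n substitutions reveal no difference between Q and Q'.
  The bound \<open>2 * rad\<close> is what two tiles with a common point allow for the distance of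
  their centres.\<close>

definition offsets :: "nat \<Rightarrow> ('n, 'l) tile set \<Rightarrow> ('n, 'l) tile set \<Rightarrow> (real ^ 'n) set" where
  "offsets n Q Q' = {z. norm z \<le> 2 * rad \<and> compat ((W ^^ n) Q) ((W ^^ n) (shift z Q'))}"

lemma origin_patches_tiles: "Q \<in> origin_patches r \<Longrightarrow> Q \<subseteq> tiles"
  unfolding origin_patches_def using near_tiles by blast

lemma shift_tiles: "P \<subseteq> tiles \<Longrightarrow> shift g P \<subseteq> tiles"
  by (auto simp: shift_def)

lemma offsets_mono:
  assumes "Q \<in> origin_patches r" "Q' \<in> origin_patches r" "n \<le> n'" shows "offsets n Q Q' \<subseteq> offsets n' Q Q'"
proof -
  obtain j where j: "n' = j + n" using assms(3) by (metis le_Suc_ex add.commute)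
  have "compat ((W ^^ n') Q) ((W ^^ n') (shift z Q'))" if "compat ((W ^^ n) Q) ((W ^^ n) (shift z Q'))" for z
    using Wn_compat[OF Wn_tiles[OF origin_patches_tiles[OF assms(1)]] Wn_tiles[OF shift_tiles[OF origin_patches_tiles[OF assms(2)]]] that, of j]
    by (simp add: j funpow_add)
  then show ?thesis unfolding offsets_def by blast
qed

text \<open>If Q and Q' come from S and S', the translates of S' by z and z' both agree with S,
  hence with each other, and z' - z would be a local period. Of the \<open>4 * rad\<close> reserved
  in the radius, half pays for the shift by z and half for transitivity.\<close>

lemma offsets_separated:
  assumes nb: "\<And>k. \<not> local_period \<rho> k" and Q: "Q \<in> origin_patches (real \<rho> + 4 * rad)" "Q' \<in> origin_patches (real \<rho> + 4 * rad)"
    and z: "z \<in> offsets n Q Q'" "z' \<in> offsets n Q Q'" "dist z z' < 1"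
  shows "z = z'"
proof (rule ccontr)
  assume neq: "z \<noteq> z'"
  define r where "r = real \<rho> + 2 * rad"
  obtain S where S: "S \<in> X" "Q = near S 0 (real \<rho> + 4 * rad)" using Q(1) unfolding origin_patches_def by blast
  obtain S' where S': "S' \<in> X" "Q' = near S' 0 (real \<rho> + 4 * rad)" using Q(2) unfolding origin_patches_def by blast
  have agree: "agree n 0 r S (shift z S')" if "z \<in> offsets n Q Q'" for z
  proof -
    have nz: "norm z \<le> 2 * rad" and c: "compat ((W ^^ n) Q) ((W ^^ n) (shift z Q'))"
      using that unfolding offsets_def by auto
    have "near S 0 r \<subseteq> Q" unfolding S(2) by (rule near_mono) (use rad(1) in \<open>simp add: r_def\<close>)
    moreover have "near S' (0 - z) r \<subseteq> Q'"
      unfolding S'(2) by (rule near_move) (use nz in \<open>simp add: r_def\<close>)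
    ultimately show ?thesis unfolding agree_def near_shift'
      using compat_mono[OF c Wn_mono Wn_mono[OF shift_mono]] by blast
  qed
  have "agree n 0 (r - 2 * rad) (shift z S') (shift z' S')"
    using agree_trans[OF X_shift[OF S'(1)] S(1) X_shift[OF S'(1)]] agree[OF z(1)] agree[OF z(2)] agree_sym by blast
  then have "agree n 0 (real \<rho>) (shift z S') (shift z (shift (z' - z) S'))" by (simp add: r_def)
  then have "agree n (0 - z) (real \<rho>) S' (shift (z' - z) S')"
    unfolding agree_shift[OF S'(1) X_shift[OF S'(1)]] .
  moreover have "norm (z' - z) \<le> 1" using z(3) by (simp add: dist_norm norm_minus_commute)
  ultimately have "local_period \<rho> n" unfolding local_period_def using S'(1) neq by (metis eq_iff_diff_eq_0)
  then show False using nb by blast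
qed

text \<open>By monotonicity, offsets from different levels can be compared at the larger level. So
  the union over all levels is separated and bounded, hence finite, and is attained at one
  level.\<close>

lemma offsets_stabilize:
  assumes nb: "\<And>k. \<not> local_period \<rho> k" and Q: "Q \<in> origin_patches (real \<rho> + 4 * rad)" "Q' \<in> origin_patches (real \<rho> + 4 * rad)"
  shows "\<exists>N. \<forall>n\<ge>N. offsets (Suc n) Q Q' \<subseteq> offsets n Q Q'"
proof -
  let ?D = "\<lambda>n. offsets n Q Q'"
  have mono: "n \<le> n' \<Longrightarrow> ?D n \<subseteq> ?D n'" for n n' using offsets_mono Q by blast
  have "finite (\<Union>n. ?D n)"
  proof (rule finite_bounded_separated[of _ 1])
    show "bounded (\<Union>n. ?D n)" by (rule boundedI[of _ "2 * rad"]) (auto simp: offsets_def)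
    fix z z' assume "z \<in> (\<Union>n. ?D n)" "z' \<in> (\<Union>n. ?D n)" and d: "dist z z' < 1"
    then obtain n n' where "z \<in> ?D n" "z' \<in> ?D n'" by blast
    then have "z \<in> ?D (max n n')" "z' \<in> ?D (max n n')" using mono[of n "max n n'"] mono[of n' "max n n'"] by auto
    then show "z = z'" using offsets_separated[OF nb Q _ _ d] by blast
  qed simp
  moreover obtain f where f: "\<And>z. z \<in> (\<Union>n. ?D n) \<Longrightarrow> z \<in> ?D (f z)" by (metis UN_E)
  ultimately have le: "f z \<le> Max (f ` (\<Union>n. ?D n))" if "z \<in> (\<Union>n. ?D n)" for z
    using that by (intro Max_ge finite_imageI imageI)
  define N where "N = Max (f ` (\<Union>n. ?D n))"
  have N: "(\<Union>n. ?D n) \<subseteq> ?D N" using f le mono unfolding N_def by blast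
  have "?D (Suc n) \<subseteq> ?D n" if "N \<le> n" for n using N mono[OF that] by blast
  then show ?thesis by blast
qed

text \<open>Overlapping tiles at level n have n-fold parents with a common point. Equality at level
  n + 1 puts the difference of the parents' centres among the offsets of level n + 1, hence among
  those of level n, where it forces the two tiles to be equal.\<close>

lemma non_periodic_imp_levels_collapse:
  assumes np: "non_periodic \<A> \<phi> \<omega>"
  shows "\<exists>n. \<forall>S\<in>X. \<forall>S'\<in>X. (W ^^ Suc n) S = (W ^^ Suc n) S' \<longrightarrow> (W ^^ n) S = (W ^^ n) S'"
proof -
  obtain \<rho> where nb: "\<And>k. \<not> local_period \<rho> k" using repulsion[OF np] by blast
  define R where "R = real \<rho> + 4 * rad"
  have R: "0 \<le> R" using rad(1) by (simp add: R_def)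
  have "\<forall>Q\<in>origin_patches R. \<forall>Q'\<in>origin_patches R. \<forall>\<^sub>F n in sequentially. offsets (Suc n) Q Q' \<subseteq> offsets n Q Q'"
    using offsets_stabilize[OF nb] unfolding R_def eventually_sequentially by blast
  \<comment> \<open>Finitely many pairs of patterns stabilize simultaneously.\<close>
  then have "\<forall>\<^sub>F n in sequentially. \<forall>Q\<in>origin_patches R. \<forall>Q'\<in>origin_patches R. offsets (Suc n) Q Q' \<subseteq> offsets n Q Q'"
    by (simp add: eventually_ball_finite_distrib finite_origin_patches[OF R])
  then obtain n where n: "\<And>Q Q'. Q \<in> origin_patches R \<Longrightarrow> Q' \<in> origin_patches R \<Longrightarrow> offsets (Suc n) Q Q' \<subseteq> offsets n Q Q'"
    unfolding eventually_sequentially by blast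
  have "(W ^^ n) S = (W ^^ n) S'" if S: "S \<in> X" "S' \<in> X" and eq: "(W ^^ Suc n) S = (W ^^ Suc n) S'" for S S'
  proof (rule tiling_eq_compat)
    show "compat ((W ^^ n) S) ((W ^^ n) S')"
      unfolding compat_def
    proof (intro ballI impI)
      fix s s' assume s: "s \<in> (W ^^ n) S" and s': "s' \<in> (W ^^ n) S'" and o: "overlap s s'"
      obtain y where y: "(\<phi> ^^ n) y \<in> interior (fst s)" "(\<phi> ^^ n) y \<in> interior (fst s')"
        using overlap_preimage[OF o] by blast
      obtain t where t: "t \<in> S" "s \<in> (W ^^ n) {t}" "y \<in> fst t"
        using Wn_point[OF X_tiles[OF S(1)] s y(1)] by blast
      obtain t' where t': "t' \<in> S'" "s' \<in> (W ^^ n) {t'}" "y \<in> fst t'"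
        using Wn_point[OF X_tiles[OF S(2)] s' y(2)] by blast
      have tt: "t \<in> tiles" "t' \<in> tiles" using t(1) t'(1) X_tiles S by blast+
      let ?c = "ctr t" and ?c' = "ctr t'"
      define z where "z = ?c' - ?c"
      let ?P = "near S ?c R" and ?P' = "near S' ?c' R"
      have Q: "near (shift (- ?c) S) 0 R = shift (- ?c) ?P" "near (shift (- ?c') S') 0 R = shift (- ?c') ?P'"
        unfolding near_shift' by simp_all
      have origin_patches: "shift (- ?c) ?P \<in> origin_patches R" "shift (- ?c') ?P' \<in> origin_patches R"
        using origin_patches_mem[OF S(1) t(1), of R] origin_patches_mem[OF S(2) t'(1), of R] unfolding Q by simp_all
      \<comment> \<open>Each pattern is normalized at its own tile; shifting by \<open>z\<close>
        restores the common coordinates.\<close>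
      have zz: "shift z (shift (- ?c') ?P') = shift (- ?c) ?P'" by (simp add: z_def)
      have "dist ?c ?c' \<le> 2 * rad"
        using dist_triangle2[of ?c ?c' y] tile_rad[OF tt(1) t(3)] tile_rad[OF tt(2) t'(3)] by simp
      then have nz: "norm z \<le> 2 * rad" by (simp add: z_def dist_norm norm_minus_commute)
      have comp: "compat ((W ^^ k) (shift (- ?c) ?P)) ((W ^^ k) (shift z (shift (- ?c') ?P')))
          \<longleftrightarrow> compat ((W ^^ k) ?P) ((W ^^ k) ?P')" for k
        unfolding zz Wn_shift[OF near_tiles[OF S(1)]] Wn_shift[OF near_tiles[OF S(2)]] by simp
      have "(W ^^ Suc n) ?P' \<subseteq> (W ^^ Suc n) S" unfolding eq by (rule Wn_mono[OF near_subset])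
      then have "compat ((W ^^ Suc n) ?P) ((W ^^ Suc n) ?P')"
        using X_compat[OF X_Wn[OF S(1)] Wn_mono[OF near_subset]] by blast
      then have "z \<in> offsets (Suc n) (shift (- ?c) ?P) (shift (- ?c') ?P')"
        unfolding offsets_def mem_Collect_eq comp using nz by blast
      then have "z \<in> offsets n (shift (- ?c) ?P) (shift (- ?c') ?P')" using n[OF origin_patches] by blast
      then have "compat ((W ^^ n) ?P) ((W ^^ n) ?P')"
        unfolding offsets_def mem_Collect_eq comp by blast
      moreover have "s \<in> (W ^^ n) ?P"
        using Wn_memI[OF near_memI[OF t(1) ctr_in[OF tt(1)]] t(2)] R by simp
      moreover have "s' \<in> (W ^^ n) ?P'"
        using Wn_memI[OF near_memI[OF t'(1) ctr_in[OF tt(2)]] t'(2)] R by simp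
      ultimately show "s = s'" using compatD o by blast
    qed
  qed (intro X_tiling X_Wn S)+
  then show ?thesis by blast
qed

text \<open>Lifting both tilings n levels back through \<open>Wn_surj\<close> turns the hypothesis
  into an equality at level n + 1.\<close>

lemma non_periodic_imp_inj:
  assumes "non_periodic \<A> \<phi> \<omega>" shows "inj_on W X"
proof (rule inj_onI)
  fix T T' assume T: "T \<in> X" "T' \<in> X" "W T = W T'"
  obtain n where n: "\<And>S S'. S \<in> X \<Longrightarrow> S' \<in> X \<Longrightarrow> (W ^^ Suc n) S = (W ^^ Suc n) S' \<Longrightarrow> (W ^^ n) S = (W ^^ n) S'"
    using non_periodic_imp_levels_collapse[OF assms] by blast
  obtain S where S: "S \<in> X" "(W ^^ n) S = T" using Wn_surj T(1) by blast
  obtain S' where S': "S' \<in> X" "(W ^^ n) S' = T'" using Wn_surj T(2) by blast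
  show "T = T'" using n[OF S(1) S'(1)] S(2) S'(2) T(3) by simp
qed

end

theorem theorem4p1:
  fixes \<A> :: "('n::finite, 'l::finite) tile set"
    and \<phi> :: "real ^ 'n \<Rightarrow> real ^ 'n"
    and \<omega> :: "('n, 'l) tile \<Rightarrow> ('n, 'l) tile set"
  assumes "tile_substitution \<A> \<phi> \<omega>"
    and "admissible \<A> \<phi> \<omega>"
    and "FPC \<A> \<phi> \<omega>"
  shows "inj_on (subst \<A> \<phi> \<omega>) (tiling_space \<A> \<phi> \<omega>) \<longleftrightarrow> non_periodic \<A> \<phi> \<omega>"
proof -
  interpret tile_subst \<A> \<phi> \<omega> using assms by unfold_locales
  show ?thesis using inj_imp_non_periodic non_periodic_imp_inj by blast
qed

end
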